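(* Consider the partly linear transformation model with current status data, the maximum penalized log-likelihood estimators $(\hat\beta_n,\hat h_n,\widehat H_n)$, and the modified estimator $\widetilde H_n$ described in the context. Assume conditions A1–A4, B1–B5 and C listed in the context. Then, as $n\to\infty$, $$|\widetilde H_n(l_v)|\vee|\widetilde H_n(u_v)|=O_p(1).$$
   Context: Data and model. $X=(V,\Delta,Z,W)$ with $V\in\mathbb{R}$, $Z\in\mathbb{R}^d$, $W\in\mathbb{R}$ and $\Delta=\mathbf 1_{(U\le V)}$, where $U$ is a real-valued outcome that is not observed directly. $X_1,\dots,X_n$ are i.i.d. copies of $X$; $\mathbb{P}_n$ denotes their empirical measure. Function classes. Fix a positive integer $\nu$. $J^2(h)=\int_a^b[h^{(\nu)}(w)]^2\,dw$, where $h^{(j)}$ is the $j$th derivative; $\Im_\nu$ is the set of functions $h:[a,b]\to\mathbb{R}$ with $J(h)<\infty$ (Sobolev sense); $\Im_{\nu,0}^{c}=\{h\in\Im_\nu:\sup_w|h(w)|<c,\ E[h(W)]=0\}$. Conditions. A1. (a) $Z$ belongs to a bounded subset $\mathcal Z\subset\mathbb{R}^d$. (b) The support of $W$ is $[a,b]$, $-\infty<a<b<\infty$. (c) The support of $V$ is an interval $[l_v,u_v]$, $-\infty<l_v<u_v<\infty$. A2. $E\,\mathrm{var}[Z\mid V,W]$ is positive definite. A3. With probability $>0$, the conditional distribution of $W$ given $V$ dominates the unconditional distribution of $W$. A4. $U$ and $V$ are independent given $(Z,W)$. B1. Given $(Z,W)$, $H_0(U)=-\beta_0'Z-h_0(W)+e$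 with $e$ having distribution function $F$; hence $P(\Delta=1\mid V,Z,W)=F(\beta_0'Z+h_0(W)+H_0(V))$. B2. $\beta_0$ belongs to a known bounded open set $B_0\subset\mathbb{R}^d$. B3. $h_0\in\Im_{\nu,0}^{c_0}$ for some known $c_0<\infty$. B4. $H_0:\mathbb{R}\to\mathbb{R}$ is strictly increasing and bounded on compacts. B5. (a) $F$ is known. (b) $F$ has first and second derivatives $f$ and $\dot f$, the support of $f$ is $\mathbb{R}$, and $|\dot f|$ is bounded. (c) For each compact $K\subset\mathbb{R}$ there exist $c\in(0,\infty)$, $\alpha\in(1/2,1]$ and an increasing bijection $\xi:[0,1]\to[0,1]$ with $\sup_{s\in K}\sup_{u,v\in[0,1]:|\xi(u)-\xi(v)|\le\epsilon}|F(F^{-1}(u)+s)-F(F^{-1}(v)+s)|\le c\,\epsilon^\alpha$ for all $\epsilon\in(0,1)$ (with $F^{-1}(0)=-\infty$, $F^{-1}(1)=\infty$). (d) $[f^2(v)-\dot f(v)F(v)]\wedge[f^2(v)+\dot f(v)(1-F(v))]>0$ for all $v\in\mathbb{R}$. C. The (possibly data-dependent) smoothing parameter satisfies $\lambda_n=O_p(n^{-1/3})$ and $\lambda_n^{-1}=O_p(n^{1/3})$. Estimators. For $x=(v,\delta,z,w)$ let $l(x;\beta,h,H)=\delta\log F[\beta'z+h(w)+H(v)]+(1-\delta)\log\{1-F[\beta'z+h(w)+H(v)]\}$ and $l_n^p(\beta,h,H)=\mathbb{P}_n l(X;\beta,h,H)-\lambda_n^2J^2(h)$. $(\hat\beta_n,\hat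 h_n,\widehat H_n)$ maximizes $l_n^p$ over $\beta\in\bar B_0$ (closure of $B_0$), $h\in\Im_\nu$ with $|h|\le c_0$ and $\mathbb{P}_nh(W)=0$, and $H$ nondecreasing; $\widehat H_n$ is taken to be a right-continuous nondecreasing step function with jumps only at the observed values of $V$. $\widehat H_n$ is allowed the values $\pm\infty$ (with $F(-\infty)=0$, $F(\infty)=1$, $0\log 0=0$). Modified estimator. Let $V_{(1)}\le\dots\le V_{(n)}$ be the order statistics of $V_1,\dots,V_n$ and $\Delta_{(i)}$ the status indicator attached to $V_{(i)}$. If $\Delta_{(j)}=1$ and $\Delta_{(j+1)}=0$ for some $j\in\{1,\dots,n-1\}$, put $k=\inf\{j:\Delta_{(j)}=1\}$, $l=\sup\{j:\Delta_{(j)}=0\}$ and define $\widetilde H_n(t)=\widehat H_n(V_{(k)})$ for $t\in[l_v,V_{(k)})$, $\widetilde H_n(t)=\widehat H_n(t)$ for $t\in[V_{(k)},V_{(l)}]$, and $\widetilde H_n(t)=\widehat H_n(V_{(l)})$ otherwise. If no such $j$ exists, put $\widetilde H_n=0$. *)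

theory Defs
  imports "HOL-Probability.Probability" "HOL-Combinatorics.Permutations"
begin

text \<open>Stochastic boundedness \<open>T\<^sub>n = O\<^sub>p(r\<^sub>n)\<close>. Estimators defined as maximisers need not be measurable,
  and \<open>measure\<close> is \<open>0\<close> on non-measurable sets; the outer measure avoids this and agrees with
  the probability on measurable events.\<close>

definition bounded_in_prob :: "'a measure \<Rightarrow> (nat \<Rightarrow> 'a \<Rightarrow> ereal) \<Rightarrow> (nat \<Rightarrow> real) \<Rightarrow> bool" where
  "bounded_in_prob M T r \<longleftrightarrow>
    (\<forall>\<epsilon>>0. \<exists>C::real. C > 0 \<and>
      (\<forall>\<^sub>F n in sequentially.
        outer_measure_of M {\<omega> \<in> space M. \<bar>T n \<omega>\<bar> > ereal (C * r n)} < ennreal \<epsilon>))"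

definition measure_support :: "'a::topological_space measure \<Rightarrow> 'a set" where
  "measure_support \<mu> = {x. \<forall>S. open S \<longrightarrow> x \<in> S \<longrightarrow> emeasure \<mu> S > 0}"

definition generated_algebra :: "'a measure \<Rightarrow> ('a \<Rightarrow> 'b::topological_space) \<Rightarrow> 'a measure" where
  "generated_algebra M Y = vimage_algebra (space M) Y borel"

definition cond_exp :: "'a measure \<Rightarrow> ('a \<Rightarrow> real) \<Rightarrow> ('a \<Rightarrow> 'b::topological_space) \<Rightarrow> 'a \<Rightarrow> real" where
  "cond_exp M f Y = real_cond_exp M (generated_algebra M Y) f"

definition cond_prob_event :: "'a measure \<Rightarrow> 'a set \<Rightarrow> ('a \<Rightarrow> 'b::topological_space) \<Rightarrow> 'a \<Rightarrow> real" where
  "cond_prob_event M A Y = cond_exp M (indicat_real A) Y"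

definition cond_indep :: "'a measure \<Rightarrow> ('a \<Rightarrow> real) \<Rightarrow> ('a \<Rightarrow> real) \<Rightarrow> ('a \<Rightarrow> 'b::topological_space) \<Rightarrow> bool" where
  "cond_indep M U V Y \<longleftrightarrow>
    (\<forall>A\<in>sets borel. \<forall>B\<in>sets borel. AE \<omega> in M.
      cond_prob_event M {\<omega> \<in> space M. U \<omega> \<in> A \<and> V \<omega> \<in> B} Y \<omega> =
      cond_prob_event M {\<omega> \<in> space M. U \<omega> \<in> A} Y \<omega> * cond_prob_event M {\<omega> \<in> space M. V \<omega> \<in> B} Y \<omega>)"

definition cond_var :: "'a measure \<Rightarrow> ('a \<Rightarrow> real^'d) \<Rightarrow> ('a \<Rightarrow> 'b::topological_space) \<Rightarrow> 'a \<Rightarrow> real^'d^'d" where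
  "cond_var M Z Y \<omega> = (\<chi> i j. cond_exp M
      (\<lambda>\<omega>. (Z \<omega> $ i - cond_exp M (\<lambda>\<omega>. Z \<omega> $ i) Y \<omega>) *
           (Z \<omega> $ j - cond_exp M (\<lambda>\<omega>. Z \<omega> $ j) Y \<omega>)) Y \<omega>)"

definition expected_cond_var :: "'a measure \<Rightarrow> ('a \<Rightarrow> real^'d) \<Rightarrow> ('a \<Rightarrow> 'b::topological_space) \<Rightarrow> real^'d^'d" where
  "expected_cond_var M Z Y = (\<chi> i j. integral\<^sup>L M (\<lambda>\<omega>. cond_var M Z Y \<omega> $ i $ j))"

definition pos_def_matrix :: "real^'d^'d \<Rightarrow> bool" where
  "pos_def_matrix A \<longleftrightarrow> transpose A = A \<and> (\<forall>x. x \<noteq> 0 \<longrightarrow> x \<bullet> (A *v x) > 0)"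

text \<open>\<open>\<kappa> v\<close> is the conditional distribution of \<open>W\<close> given \<open>V = v\<close>.\<close>

definition regular_cond_distr :: "'a measure \<Rightarrow> ('a \<Rightarrow> real) \<Rightarrow> ('a \<Rightarrow> real) \<Rightarrow> (real \<Rightarrow> real measure) \<Rightarrow> bool" where
  "regular_cond_distr M W V \<kappa> \<longleftrightarrow>
    \<kappa> \<in> borel \<rightarrow>\<^sub>M prob_algebra borel \<and>
    (\<forall>A\<in>sets borel. \<forall>B\<in>sets borel.
      emeasure M {\<omega> \<in> space M. V \<omega> \<in> A \<and> W \<omega> \<in> B} =
      (\<integral>\<^sup>+v\<in>A. emeasure (\<kappa> v) B \<partial>distr M borel V))"

text \<open>The set \<open>S\<close> of \<open>v\<close> at which domination holds is only required to contain a Borel set of positive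
  probability, so its measurability is not an issue. Regular versions agree almost everywhere, so
  the choice of \<open>\<kappa>\<close> does not matter. In \<open>absolutely_continuous\<close> the dominating measure comes
  first.\<close>

definition cond_distr_dominates :: "'a measure \<Rightarrow> ('a \<Rightarrow> real) \<Rightarrow> ('a \<Rightarrow> real) \<Rightarrow> bool" where
  "cond_distr_dominates M W V \<longleftrightarrow>
    (\<exists>\<kappa>. regular_cond_distr M W V \<kappa> \<and>
      (\<exists>S\<in>sets borel. measure M {\<omega> \<in> space M. V \<omega> \<in> S} > 0 \<and>
        (\<forall>v\<in>S. absolutely_continuous (\<kappa> v) (distr M borel W))))"

text \<open>\<open>D j\<close>, \<open>j \<le> \<nu>\<close>, are the Sobolev derivatives of \<open>h\<close> on \<open>[a,b]\<close>: for \<open>j < \<nu>\<close>, \<open>D j\<close> is absolutely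
  continuous with almost-everywhere derivative \<open>D (Suc j)\<close>. Functions on \<open>[a,b]\<close> are represented by functions
  on the line whose values outside \<open>[a,b]\<close> are irrelevant.\<close>

definition sobolev_derivs :: "real \<Rightarrow> real \<Rightarrow> nat \<Rightarrow> (real \<Rightarrow> real) \<Rightarrow> (nat \<Rightarrow> real \<Rightarrow> real) \<Rightarrow> bool" where
  "sobolev_derivs a b \<nu> h D \<longleftrightarrow>
    (\<forall>w\<in>{a..b}. D 0 w = h w) \<and>
    (\<forall>j<\<nu>. set_integrable lborel {a..b} (D (Suc j)) \<and>
      (\<forall>w\<in>{a..b}. D j w = D j a + (LINT t:{a..w}|lborel. D (Suc j) t)))"

text \<open>\<open>J\<^sup>2(h)\<close>. Since \<open>D \<nu>\<close> is determined almost everywhere by \<open>h\<close>, the infimum is over a single value,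
  or over the empty set, giving \<open>\<infinity>\<close>, when \<open>h\<close> lacks Sobolev derivatives.\<close>

definition J_squared :: "real \<Rightarrow> real \<Rightarrow> nat \<Rightarrow> (real \<Rightarrow> real) \<Rightarrow> ennreal" where
  "J_squared a b \<nu> h =
    (INF D\<in>{D. sobolev_derivs a b \<nu> h D}. \<integral>\<^sup>+w\<in>{a..b}. ennreal ((D \<nu> w)\<^sup>2) \<partial>lborel)"

definition sobolev_class :: "real \<Rightarrow> real \<Rightarrow> nat \<Rightarrow> (real \<Rightarrow> real) set" where
  "sobolev_class a b \<nu> = {h. J_squared a b \<nu> h < \<infinity>}"

text \<open>\<open>E[h(W)]\<close> is taken over \<open>[a,b]\<close>, the support of \<open>W\<close>, because \<open>h\<close> is arbitrary elsewhere.\<close>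

definition sobolev_class_centered ::
  "'a measure \<Rightarrow> ('a \<Rightarrow> real) \<Rightarrow> real \<Rightarrow> real \<Rightarrow> nat \<Rightarrow> real \<Rightarrow> (real \<Rightarrow> real) set" where
  "sobolev_class_centered M W a b \<nu> c =
    {h \<in> sobolev_class a b \<nu>. (SUP w\<in>{a..b}. ereal \<bar>h w\<bar>) < ereal c \<and>
       (LINT w:{a..b}|distr M borel W. h w) = 0}"

definition ext_cdf :: "(real \<Rightarrow> real) \<Rightarrow> ereal \<Rightarrow> real" where
  "ext_cdf F t = (case t of ereal x \<Rightarrow> F x | PInfty \<Rightarrow> 1 | MInfty \<Rightarrow> 0)"

text \<open>Used only for \<open>u\<close> in \<open>[0,1]\<close> and strictly increasing \<open>F\<close> with range \<open>(0,1)\<close>.\<close>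

definition ext_quantile :: "(real \<Rightarrow> real) \<Rightarrow> real \<Rightarrow> ereal" where
  "ext_quantile F u = (if u = 0 then -\<infinity> else if u = 1 then \<infinity> else ereal (inv F u))"

definition holder_quantile_condition :: "(real \<Rightarrow> real) \<Rightarrow> bool" where
  "holder_quantile_condition F \<longleftrightarrow>
    (\<forall>K::real set. compact K \<longrightarrow>
      (\<exists>c>0. \<exists>\<alpha>::real. 1/2 < \<alpha> \<and> \<alpha> \<le> 1 \<and>
        (\<exists>\<xi>::real \<Rightarrow> real. bij_betw \<xi> {0..1} {0..1} \<and> strict_mono_on {0..1} \<xi> \<and>
          (\<forall>\<epsilon>. 0 < \<epsilon> \<and> \<epsilon> < 1 \<longrightarrow>
            (\<forall>s\<in>K. \<forall>u\<in>{0..1}. \<forall>v\<in>{0..1}. \<bar>\<xi> u - \<xi> v\<bar> \<le> \<epsilon> \<longrightarrow>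
              \<bar>ext_cdf F (ext_quantile F u + ereal s) - ext_cdf F (ext_quantile F v + ereal s)\<bar>
                \<le> c * \<epsilon> powr \<alpha>)))))"

text \<open>An observation \<open>x = (v, \<delta>, z, w)\<close>.\<close>

type_synonym 'd obs = "real \<times> real \<times> (real^'d) \<times> real"

definition obs_v :: "'d obs \<Rightarrow> real" where "obs_v x = fst x"
definition obs_\<delta> :: "'d obs \<Rightarrow> real" where "obs_\<delta> x = fst (snd x)"
definition obs_w :: "'d obs \<Rightarrow> real" where "obs_w x = snd (snd (snd x))"

text \<open>\<open>ln 0 = 0\<close> on the reals, whereas the likelihood needs \<open>log 0 = -\<infinity>\<close>; the convention
  \<open>0 log 0 = 0\<close> is the one of multiplication on \<open>ereal\<close>.\<close>

definition ext_ln :: "real \<Rightarrow> ereal" where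
  "ext_ln p = (if p > 0 then ereal (ln p) else -\<infinity>)"

definition log_lik ::
  "(real \<Rightarrow> real) \<Rightarrow> 'd obs \<Rightarrow> real^'d \<Rightarrow> (real \<Rightarrow> real) \<Rightarrow> (real \<Rightarrow> ereal) \<Rightarrow> ereal" where
  "log_lik F x \<beta> h H = (case x of (v, \<delta>, z, w) \<Rightarrow>
     let p = ext_cdf F (ereal (\<beta> \<bullet> z + h w) + H v)
     in ereal \<delta> * ext_ln p + ereal (1 - \<delta>) * ext_ln (1 - p))"

definition pen_log_lik ::
  "(real \<Rightarrow> real) \<Rightarrow> real \<Rightarrow> real \<Rightarrow> nat \<Rightarrow> nat \<Rightarrow> (nat \<Rightarrow> 'd obs) \<Rightarrow> real \<Rightarrow>
    real^'d \<Rightarrow> (real \<Rightarrow> real) \<Rightarrow> (real \<Rightarrow> ereal) \<Rightarrow> ereal" where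
  "pen_log_lik F a b \<nu> n x lam \<beta> h H =
     ereal (1 / real n) * (\<Sum>i\<in>{1..n}. log_lik F (x i) \<beta> h H)
       - ereal (lam\<^sup>2 * enn2real (J_squared a b \<nu> h))"

definition admissible ::
  "(real^'d) set \<Rightarrow> real \<Rightarrow> real \<Rightarrow> real \<Rightarrow> nat \<Rightarrow> nat \<Rightarrow> (nat \<Rightarrow> 'd obs) \<Rightarrow>
    real^'d \<Rightarrow> (real \<Rightarrow> real) \<Rightarrow> (real \<Rightarrow> ereal) \<Rightarrow> bool" where
  "admissible B0 c0 a b \<nu> n x \<beta> h H \<longleftrightarrow>
     \<beta> \<in> closure B0 \<and>
     h \<in> sobolev_class a b \<nu> \<and> (\<forall>w\<in>{a..b}. \<bar>h w\<bar> \<le> c0) \<and>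
     (\<Sum>i\<in>{1..n}. h (obs_w (x i))) / real n = 0 \<and>
     mono H"

definition step_function_jumps_in :: "real set \<Rightarrow> (real \<Rightarrow> ereal) \<Rightarrow> bool" where
  "step_function_jumps_in S H \<longleftrightarrow>
     mono H \<and> finite (range H) \<and> (\<forall>t. continuous (at_right t) H) \<and> (\<forall>t. t \<notin> S \<longrightarrow> isCont H t)"

definition is_MPLE ::
  "(real \<Rightarrow> real) \<Rightarrow> (real^'d) set \<Rightarrow> real \<Rightarrow> real \<Rightarrow> real \<Rightarrow> nat \<Rightarrow> nat \<Rightarrow> (nat \<Rightarrow> 'd obs) \<Rightarrow> real \<Rightarrow>
    real^'d \<Rightarrow> (real \<Rightarrow> real) \<Rightarrow> (real \<Rightarrow> ereal) \<Rightarrow> bool" where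
  "is_MPLE F B0 c0 a b \<nu> n x lam \<beta>' h' H' \<longleftrightarrow>
     admissible B0 c0 a b \<nu> n x \<beta>' h' H' \<and>
     step_function_jumps_in ((\<lambda>i. obs_v (x i)) ` {1..n}) H' \<and>
     (\<forall>\<beta> h H. admissible B0 c0 a b \<nu> n x \<beta> h H \<longrightarrow>
        pen_log_lik F a b \<nu> n x lam \<beta> h H \<le> pen_log_lik F a b \<nu> n x lam \<beta>' h' H')"

text \<open>\<open>\<sigma>\<close> orders the sample: \<open>V\<^bsub>(j)\<^esub>\<close> is \<open>obs_v (x (\<sigma> j))\<close> and \<open>\<Delta>\<^bsub>(j)\<^esub>\<close> is \<open>obs_\<delta> (x (\<sigma> j))\<close>. Ties among the
  \<open>V\<close> may be broken in any way.\<close>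

definition sorts_sample :: "nat \<Rightarrow> (nat \<Rightarrow> 'd obs) \<Rightarrow> (nat \<Rightarrow> nat) \<Rightarrow> bool" where
  "sorts_sample n x \<sigma> \<longleftrightarrow>
     \<sigma> permutes {1..n} \<and> (\<forall>i\<in>{1..n}. \<forall>j\<in>{1..n}. i \<le> j \<longrightarrow> obs_v (x (\<sigma> i)) \<le> obs_v (x (\<sigma> j)))"

definition modified_H ::
  "real \<Rightarrow> nat \<Rightarrow> (nat \<Rightarrow> 'd obs) \<Rightarrow> (nat \<Rightarrow> nat) \<Rightarrow> (real \<Rightarrow> ereal) \<Rightarrow> real \<Rightarrow> ereal" where
  "modified_H lv n x \<sigma> H t =
     (let Vo = (\<lambda>j. obs_v (x (\<sigma> j))); \<Delta>o = (\<lambda>j. obs_\<delta> (x (\<sigma> j)));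
          k = Inf {j\<in>{1..n}. \<Delta>o j = 1}; l = Sup {j\<in>{1..n}. \<Delta>o j = 0}
      in if \<exists>j\<in>{1..<n}. \<Delta>o j = 1 \<and> \<Delta>o (j + 1) = 0
         then (if lv \<le> t \<and> t < Vo k then H (Vo k)
               else if Vo k \<le> t \<and> t \<le> Vo l then H t
               else H (Vo l))
         else 0)"

end

theory Submission
  imports Defs
begin

text \<open>For fixed \<open>\<beta>\<close> and \<open>h\<close> the estimator of \<open>H\<close> solves a generalised isotonic regression problem with
  uniformly bounded offsets \<open>\<beta>'Z + h(W)\<close>. Since \<open>F\<close> and \<open>1 - F\<close> are strictly log-concave, its lowest value
  at a success (\<open>\<Delta> = 1\<close>) cannot be very negative as long as every initial segment \<open>{i. V\<^sub>i \<le> t}\<close> that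
  contains a success contains a fraction at least \<open>\<rho>\<close> of successes: otherwise raising the bottom block would increase
  the likelihood. By conditional independence of \<open>U\<close> and \<open>V\<close>, a success has probability at least some \<open>p > 0\<close>
  uniformly in the value of \<open>V\<close>, so a Chernoff bound for each possible initial segment, summed over the segments of
  size at least \<open>m\<close>, shows that such a \<open>\<rho>\<close> exists with probability close to one, uniformly in \<open>n\<close>. The upper bound
  follows by the reflection \<open>V \<mapsto> -V\<close>, \<open>\<Delta> \<mapsto> 1 - \<Delta>\<close>, \<open>F \<mapsto> 1 - F(-\<cdot>)\<close>.\<close>

section \<open>Isotonic maximum likelihood for log-concave links\<close>

text \<open>One term of the log-likelihood, with the offset \<open>a\<close> kept apart from the
  value \<open>\<eta>\<close> of the monotone component, since only the latter will vary. The status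
  is a Boolean so that reflection becomes negation.\<close>

definition cell_log_lik :: "(real \<Rightarrow> real) \<Rightarrow> bool \<Rightarrow> real \<Rightarrow> ereal \<Rightarrow> ereal" where
  "cell_log_lik F success a \<eta> =
    (let p = ext_cdf F (ereal a + \<eta>) in if success then ext_ln p else ext_ln (1 - p))"

text \<open>Reflection exchanges \<open>F\<close> and \<open>1 - F\<close>. This includes infinite
  \<open>\<eta>\<close>, where \<open>ext_cdf\<close> takes the values 0 and 1.\<close>

lemma cell_log_lik_reflect:
  "cell_log_lik (\<lambda>x. 1 - F (- x)) (\<not> success) (- a) (- \<eta>) = cell_log_lik F success a \<eta>"
proof -
  have "ext_cdf (\<lambda>x. 1 - F (- x)) (ereal (- a) + - \<eta>) = 1 - ext_cdf F (ereal a + \<eta>)"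
    by (cases \<eta>) (auto simp: ext_cdf_def add.commute)
  then show ?thesis
    by (simp add: cell_log_lik_def Let_def)
qed

text \<open>The profile problem in the monotone component: the offsets \<open>a\<close> stay fixed,
  and competitors may take infinite values.\<close>

definition isotonic_mle :: "(real \<Rightarrow> real) \<Rightarrow> 'i set \<Rightarrow> 'i set \<Rightarrow> ('i \<Rightarrow> real) \<Rightarrow> ('i \<Rightarrow> real) \<Rightarrow> (real \<Rightarrow> ereal) \<Rightarrow> bool" where
  "isotonic_mle F I s a v H \<longleftrightarrow> mono H \<and>
    (\<forall>G. mono G \<longrightarrow> (\<Sum>i\<in>I. cell_log_lik F (i \<in> s) (a i) (G (v i))) \<le>
      (\<Sum>i\<in>I. cell_log_lik F (i \<in> s) (a i) (H (v i))))"

text \<open>Segments without a success are exempt: they consist of failures, which put no lower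
  limit on \<open>H\<close>.\<close>

definition success_ratio_ge :: "real \<Rightarrow> 'i set \<Rightarrow> 'i set \<Rightarrow> ('i \<Rightarrow> real) \<Rightarrow> bool" where
  "success_ratio_ge \<rho> I s v \<longleftrightarrow>
    (\<forall>t. {i \<in> s. v i \<le> t} \<noteq> {} \<longrightarrow> \<rho> * card {i \<in> I. v i \<le> t} \<le> card {i \<in> s. v i \<le> t})"

text \<open>The last two assumptions are the negativity of \<open>(ln F)''\<close> and
  \<open>(ln (1 - F))''\<close>, cleared of denominators so that they make sense before
  \<open>F\<close> is known to lie strictly between 0 and 1.\<close>

locale log_concave_cdf =
  fixes F f f' :: "real \<Rightarrow> real"
  assumes mono_F: "mono F"
    and lim_bot: "(F \<longlongrightarrow> 0) at_bot"
    and lim_top: "(F \<longlongrightarrow> 1) at_top"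
    and deriv_F: "\<And>t. (F has_real_derivative f t) (at t)"
    and deriv_f: "\<And>t. (f has_real_derivative f' t) (at t)"
    and concave: "\<And>t. f' t * F t < (f t)\<^sup>2"
    and concave_compl: "\<And>t. 0 < (f t)\<^sup>2 + f' t * (1 - F t)"
begin

section \<open>Positivity, hazards and increments of the log-likelihood\<close>

lemma F_nonneg: "0 \<le> F t"
proof -
  have "\<forall>\<^sub>F s in at_bot. F s \<le> F t"
    using eventually_le_at_bot[of t] by eventually_elim (rule monoD[OF mono_F])
  then show ?thesis
    using tendsto_upperbound[OF lim_bot] by simp
qed

lemma F_le_1: "F t \<le> 1"
proof -
  have "\<forall>\<^sub>F s in at_top. F t \<le> F s"
    using eventually_ge_at_top[of t] by eventually_elim (rule monoD[OF mono_F])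
  then show ?thesis
    using tendsto_lowerbound[OF lim_top] by simp
qed

text \<open>At a zero of \<^term>\<open>F\<close>, of \<^term>\<open>\<lambda>t. 1 - F t\<close> or of \<^term>\<open>f\<close>, which would be a minimum, the next
  derivative vanishes as well, contradicting the strict inequalities.\<close>

lemma F_pos: "0 < F t"
proof (rule ccontr)
  assume "\<not> 0 < F t"
  then have 0: "F t = 0"
    using F_nonneg[of t] by simp
  have "f t = 0"
    by (rule DERIV_local_min[OF deriv_F, of 1]) (use F_nonneg 0 in auto)
  then show False
    using concave[of t] 0 by simp
qed

lemma F_less_1: "F t < 1"
proof (rule ccontr)
  assume "\<not> F t < 1"
  then have 0: "F t = 1"
    using F_le_1[of t] by simp
  have "f t = 0"
    by (rule DERIV_local_max[OF deriv_F, of 1]) (use F_le_1 0 in auto)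
  then show False
    using concave_compl[of t] 0 by simp
qed

lemma f_nonneg: "0 \<le> f t"
  by (rule mono_on_imp_deriv_nonneg[OF _ deriv_F, of UNIV]) (use mono_F in auto)

lemma f_pos: "0 < f t"
proof (rule ccontr)
  assume "\<not> 0 < f t"
  then have 0: "f t = 0"
    using f_nonneg[of t] by simp
  have "f' t = 0"
    by (rule DERIV_local_min[OF deriv_f, of 1]) (use f_nonneg 0 in auto)
  then show False
    using concave[of t] 0 by simp
qed

text \<open>The hazard is minus the derivative of \<open>ln (1 - F)\<close>, hence nondecreasing by
  concavity. In the next lemma \<open>f / F\<close> is the derivative of \<open>ln F\<close>, hence
  nonincreasing.\<close>

lemma hazard_mono: "x \<le> y \<Longrightarrow> f x / (1 - F x) \<le> f y / (1 - F y)"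
proof (erule DERIV_nonneg_imp_nondecreasing)
  fix t
  have 1: "1 - F t \<noteq> 0"
    using F_less_1[of t] by simp
  have "((\<lambda>t. f t / (1 - F t)) has_real_derivative
      (f' t * (1 - F t) - f t * (0 - f t)) / ((1 - F t) * (1 - F t))) (at t)"
    by (intro derivative_intros deriv_f deriv_F 1)
  moreover have "0 \<le> (f' t * (1 - F t) - f t * (0 - f t)) / ((1 - F t) * (1 - F t))"
    using concave_compl[of t] by (intro divide_nonneg_nonneg) (auto simp: power2_eq_square)
  ultimately show "\<exists>d. ((\<lambda>t. f t / (1 - F t)) has_real_derivative d) (at t) \<and> 0 \<le> d"
    by blast
qed

lemma reversed_hazard_antimono: "x \<le> y \<Longrightarrow> f y / F y \<le> f x / F x"
proof (erule DERIV_nonpos_imp_nonincreasing)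
  fix t
  have 1: "F t \<noteq> 0"
    using F_pos[of t] by simp
  have "((\<lambda>t. f t / F t) has_real_derivative
      (f' t * F t - f t * f t) / (F t * F t)) (at t)"
    by (intro derivative_intros deriv_f deriv_F 1)
  moreover have "(f' t * F t - f t * f t) / (F t * F t) \<le> 0"
    using concave[of t] by (intro divide_nonpos_nonneg) (auto simp: power2_eq_square)
  ultimately show "\<exists>d. ((\<lambda>t. f t / F t) has_real_derivative d) (at t) \<and> d \<le> 0"
    by blast
qed

text \<open>The mean value theorem turns the increment into a slope, and concavity puts every slope
  left of \<open>u\<close> above the slope at \<open>u\<close>. One constant thus serves all
  intervals ending at or before \<open>u\<close>, whatever the offset.\<close>

lemma ln_F_increment:
  assumes "x < y" "y \<le> u"
  shows "f u / F u * (y - x) \<le> ln (F y) - ln (F x)"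
proof -
  have "((\<lambda>t. ln (F t)) has_real_derivative f t / F t) (at t)" for t
    using F_pos[of t] by (auto intro!: derivative_eq_intros deriv_F)
  from MVT2[OF \<open>x < y\<close> this] obtain z where z: "x < z" "z < y"
      "ln (F y) - ln (F x) = (y - x) * (f z / F z)"
    by blast
  show ?thesis
    using reversed_hazard_antimono[of z u] z assms
    by (simp add: mult.commute[of _ "y - x"] mult_left_mono del: times_divide_eq_right times_divide_eq_left)
qed

text \<open>Here the slope is minus the hazard, which left of \<open>u\<close> is at most the hazard
  at \<open>u\<close>; this caps the loss of a failure.\<close>

lemma ln_compl_F_increment:
  assumes "x < y" "y \<le> u"
  shows "- (f u / (1 - F u)) * (y - x) \<le> ln (1 - F y) - ln (1 - F x)"
proof -
  have "((\<lambda>t. ln (1 - F t)) has_real_derivative - (f t / (1 - F t))) (at t)" for t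
    using F_less_1[of t] by (auto intro!: derivative_eq_intros deriv_F)
  from MVT2[OF \<open>x < y\<close> this] obtain z where z: "x < z" "z < y"
      "ln (1 - F y) - ln (1 - F x) = (y - x) * - (f z / (1 - F z))"
    by blast
  show ?thesis
    using hazard_mono[of z u] z assms
    by (simp add: mult.commute[of _ "y - x"] mult_left_mono del: times_divide_eq_right times_divide_eq_left)
qed

text \<open>\<open>- ln (1 - F)\<close> is the cumulative hazard and tends to 0 on the left. A unit
  interval far to the left therefore has a small increment, which bounds the hazard at some inner
  point.\<close>

lemma hazard_small:
  assumes "0 < b"
  obtains u where "f u / (1 - F u) < b"
proof -
  have "((\<lambda>t. - ln (1 - F t)) \<longlongrightarrow> - ln (1 - 0)) at_bot"
    by (intro tendsto_intros lim_bot) auto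
  then have "\<forall>\<^sub>F t in at_bot. - ln (1 - F t) < b"
    using assms by (intro order_tendstoD) auto
  then obtain u where u: "- ln (1 - F (u + 1)) < b"
    by (auto simp: eventually_at_bot_linorder) (metis diff_add_cancel order_refl)
  have "((\<lambda>t. ln (1 - F t)) has_real_derivative - (f t / (1 - F t))) (at t)" for t
    using F_less_1[of t] by (auto intro!: derivative_eq_intros deriv_F)
  from MVT2[OF less_add_one[of u] this] obtain z where z: "u < z"
      "ln (1 - F (u + 1)) - ln (1 - F u) = - (f z / (1 - F z))"
    by auto
  have "ln (1 - F u) \<le> 0"
    using F_pos[of u] F_less_1[of u] by simp
  then have "f z / (1 - F z) < b"
    using z u by linarith
  then show ?thesis
    by (rule that)
qed

text \<open>For \<open>F\<close> the law of an error this is the law of its negative. The two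
  concavity conditions change places, so statements about successes become statements about
  failures.\<close>

lemma reflect: "log_concave_cdf (\<lambda>x. 1 - F (- x)) (\<lambda>x. f (- x)) (\<lambda>x. - f' (- x))"
proof
  show "mono (\<lambda>x. 1 - F (- x))"
    using mono_F by (auto simp: mono_def)
  have "((\<lambda>x. 1 - F (- x)) \<longlongrightarrow> 1 - 1) at_bot"
    by (intro tendsto_intros filterlim_compose[OF lim_top filterlim_uminus_at_top_at_bot])
  then show "((\<lambda>x. 1 - F (- x)) \<longlongrightarrow> 0) at_bot"
    by simp
  have "((\<lambda>x. 1 - F (- x)) \<longlongrightarrow> 1 - 0) at_top"
    by (intro tendsto_intros filterlim_compose[OF lim_bot filterlim_uminus_at_bot_at_top])
  then show "((\<lambda>x. 1 - F (- x)) \<longlongrightarrow> 1) at_top"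
    by simp
  show "((\<lambda>x. 1 - F (- x)) has_real_derivative f (- t)) (at t)" for t
    by (auto intro!: derivative_eq_intros DERIV_chain2[OF deriv_F])
  show "((\<lambda>x. f (- x)) has_real_derivative - f' (- t)) (at t)" for t
    by (rule DERIV_cong[OF DERIV_chain2[OF deriv_f]]) (auto intro!: derivative_eq_intros)
  show "- f' (- t) * (1 - F (- t)) < (f (- t))\<^sup>2" for t
    using concave_compl[of "- t"] by simp
  show "0 < (f (- t))\<^sup>2 + - f' (- t) * (1 - (1 - F (- t)))" for t
    using concave[of "- t"] by simp
qed

section \<open>Levels of isotonic maximisers at successes and failures\<close>

lemma cell_log_lik_real:
  "cell_log_lik F success a (ereal c) = ereal (if success then ln (F (a + c)) else ln (1 - F (a + c)))"
  using F_pos F_less_1 by (simp add: cell_log_lik_def ext_cdf_def ext_ln_def)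

lemma cell_log_lik_nonpos: "cell_log_lik F success a \<eta> \<le> 0"
  using F_pos[of "a + real_of_ereal \<eta>"] F_less_1[of "a + real_of_ereal \<eta>"]
  by (cases \<eta>) (auto simp: cell_log_lik_def ext_cdf_def ext_ln_def less_imp_le Let_def)

text \<open>Far to the left, raising the common value of a block by \<open>d\<close> gains at least \<open>g * d\<close> per success and
  loses at most \<open>r * d\<close> per failure, where \<open>r\<close> is arbitrarily small compared with \<open>g\<close>.\<close>

lemma block_threshold:
  fixes \<rho> K :: real
  assumes "0 < \<rho>"
  shows "\<exists>C>0. \<forall>D s a c c'. finite (D :: 'i set) \<longrightarrow> s \<subseteq> D \<longrightarrow> s \<noteq> {} \<longrightarrow> \<rho> * card D \<le> card s \<longrightarrow>
    (\<forall>i\<in>D. \<bar>a i\<bar> \<le> K) \<longrightarrow> c < c' \<longrightarrow> c' \<le> - C \<longrightarrow>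
    (\<Sum>i\<in>D. cell_log_lik F (i \<in> s) (a i) (ereal c)) < (\<Sum>i\<in>D. cell_log_lik F (i \<in> s) (a i) (ereal c'))"
proof -
  define g where "g = f 0 / F 0"
  have g: "0 < g"
    using f_pos F_pos by (simp add: g_def)
  \<comment> \<open>The gain rate \<open>g\<close> per success is fixed first; \<open>u\<close> is
    then chosen to make the loss rate per failure less than \<open>g * \<rho>\<close>.\<close>
  obtain u where u: "f u / (1 - F u) < g * \<rho>"
    using hazard_small[of "g * \<rho>"] g assms by auto
  define r where "r = f u / (1 - F u)"
  have r: "0 < r" "r < g * \<rho>"
    using u f_pos[of u] F_less_1[of u] by (auto simp: r_def)
  \<comment> \<open>This moves every \<open>a i + c'\<close> below both 0 and \<open>u\<close>,
    where the rates \<open>g\<close> and \<open>r\<close> apply.\<close>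
  define C where "C = \<bar>K\<bar> + \<bar>u\<bar> + 1"
  show ?thesis
  proof (intro exI[of _ C] conjI allI impI)
    show "0 < C"
      by (simp add: C_def)
    fix D s :: "'i set" and a and c c' :: real
    assume D: "finite D" "s \<subseteq> D" "s \<noteq> {}" "\<rho> * card D \<le> card s"
      and a: "\<forall>i\<in>D. \<bar>a i\<bar> \<le> K" and c: "c < c'" "c' \<le> - C"
    have fin: "finite s"
      using D finite_subset by blast
    have le: "a i + c' \<le> 0" "a i + c' \<le> u" if "i \<in> D" for i
      using a that c by (auto simp: C_def)
    have "0 < card s"
      using D fin by (simp add: card_gt_0_iff)
    \<comment> \<open>Even if all of \<open>D\<close> were charged the loss rate \<open>r\<close>,
      the share \<open>\<rho>\<close> of successes gains more.\<close>
    have "r * real (card D - card s) \<le> r * card D"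
      using r by (intro mult_left_mono) auto
    also have "\<dots> < g * \<rho> * card D"
      using r D fin by (intro mult_strict_right_mono) (auto simp: card_gt_0_iff)
    also have "\<dots> \<le> g * card s"
      using D(4) g by (simp add: mult.assoc)
    finally have "0 < (c' - c) * (g * card s - r * real (card D - card s))"
      using c by simp
    also have "\<dots> = (\<Sum>i\<in>s. g * (c' - c)) + (\<Sum>i\<in>D - s. - r * (c' - c))"
      using D fin by (simp add: card_Diff_subset algebra_simps)
    also have "\<dots> = (\<Sum>i\<in>D. if i \<in> s then g * (c' - c) else - r * (c' - c))"
      using D by (simp add: sum.If_cases Int_absorb1 Diff_eq)
    also have "\<dots> \<le> (\<Sum>i\<in>D. if i \<in> s then ln (F (a i + c')) - ln (F (a i + c))
        else ln (1 - F (a i + c')) - ln (1 - F (a i + c)))"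
    proof (intro sum_mono)
      fix i assume i: "i \<in> D"
      show "(if i \<in> s then g * (c' - c) else - r * (c' - c)) \<le>
        (if i \<in> s then ln (F (a i + c')) - ln (F (a i + c))
        else ln (1 - F (a i + c')) - ln (1 - F (a i + c)))"
        using ln_F_increment[of "a i + c" "a i + c'" 0] ln_compl_F_increment[of "a i + c" "a i + c'" u]
          le[OF i] c by (auto simp: g_def r_def)
    qed
    also have "\<dots> = (\<Sum>i\<in>D. if i \<in> s then ln (F (a i + c')) else ln (1 - F (a i + c'))) -
        (\<Sum>i\<in>D. if i \<in> s then ln (F (a i + c)) else ln (1 - F (a i + c)))"
      by (simp add: sum_subtractf[symmetric] if_distrib cong: if_cong)
    finally show "(\<Sum>i\<in>D. cell_log_lik F (i \<in> s) (a i) (ereal c)) < (\<Sum>i\<in>D. cell_log_lik F (i \<in> s) (a i) (ereal c'))"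
      by (simp add: cell_log_lik_real)
  qed
qed

text \<open>If the lowest level of \<open>H\<close> at a success were below \<open>- C\<close>,
  lifting that block to the next level would keep monotonicity and raise the likelihood.\<close>

lemma isotonic_mle_lower_bound:
  fixes \<rho> K :: real
  assumes "0 < \<rho>"
  shows "\<exists>C>0. \<forall>I s a v H. finite (I :: 'i set) \<longrightarrow> s \<subseteq> I \<longrightarrow> (\<forall>i\<in>I. \<bar>a i\<bar> \<le> K) \<longrightarrow>
    isotonic_mle F I s a v H \<longrightarrow> success_ratio_ge \<rho> I s v \<longrightarrow> (\<forall>j\<in>s. ereal (- C) \<le> H (v j))"
proof -
  obtain C where "0 < C" and C: "\<forall>D s a c c'. finite (D :: 'i set) \<longrightarrow> s \<subseteq> D \<longrightarrow> s \<noteq> {} \<longrightarrow> \<rho> * card D \<le> card s \<longrightarrow>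
      (\<forall>i\<in>D. \<bar>a i\<bar> \<le> K) \<longrightarrow> c < c' \<longrightarrow> c' \<le> - C \<longrightarrow>
      (\<Sum>i\<in>D. cell_log_lik F (i \<in> s) (a i) (ereal c)) < (\<Sum>i\<in>D. cell_log_lik F (i \<in> s) (a i) (ereal c'))"
    using block_threshold[OF assms, where K = K] by (elim exE conjE)
  show ?thesis
  proof (intro exI[of _ C] conjI allI impI ballI)
    show "0 < C"
      by fact
    fix I s :: "'i set" and a v :: "'i \<Rightarrow> real" and H :: "real \<Rightarrow> ereal" and j
    let ?l = "\<lambda>i. cell_log_lik F (i \<in> s) (a i)"
    assume I: "finite I" "s \<subseteq> I" and a: "\<forall>i\<in>I. \<bar>a i\<bar> \<le> K"
      and mle: "isotonic_mle F I s a v H" and ratio: "success_ratio_ge \<rho> I s v" and j: "j \<in> s"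
    have H: "mono H"
      and opt: "\<And>G. mono G \<Longrightarrow> (\<Sum>i\<in>I. ?l i (G (v i))) \<le> (\<Sum>i\<in>I. ?l i (H (v i)))"
      using mle by (auto simp: isotonic_mle_def)
    \<comment> \<open>The constant 0 has finite likelihood and no term is positive, so every term at
      the maximiser is finite. Sums in \<open>ereal\<close> can then be split and compared
      strictly.\<close>
    have fin: "\<bar>?l i (H (v i))\<bar> \<noteq> \<infinity>" if "i \<in> I" for i
    proof -
      have "(\<Sum>i\<in>I. ?l i (ereal 0)) \<noteq> - \<infinity>"
        by (simp add: cell_log_lik_real)
      moreover have "(\<Sum>i\<in>I. ?l i (ereal 0)) \<le> (\<Sum>i\<in>I. ?l i (H (v i)))"
        using opt[of "\<lambda>_. ereal 0"] by (simp add: mono_def)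
      moreover have "(\<Sum>i\<in>I. ?l i (H (v i))) \<le> 0"
        by (intro sum_nonpos cell_log_lik_nonpos)
      ultimately have "\<bar>\<Sum>i\<in>I. ?l i (H (v i))\<bar> \<noteq> \<infinity>"
        by auto
      then show ?thesis
        using that I by (auto simp: sum_Inf)
    qed
    show "ereal (- C) \<le> H (v j)"
    proof (rule ccontr)
      assume contr: "\<not> ereal (- C) \<le> H (v j)"
      define v0 where "v0 = Min (v ` s)"
      have fs: "finite s"
        using I finite_subset by blast
      have "v0 \<in> v ` s"
        unfolding v0_def using fs j by (intro Min_in) auto
      then obtain i0 where i0: "i0 \<in> s" "v i0 = v0"
        by auto
      have v0_le: "v0 \<le> v i" if "i \<in> s" for i
        unfolding v0_def using fs that by (intro Min_le) auto
      have "H v0 < ereal (- C)"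
        using contr monoD[OF H v0_le[OF j]] by auto
      moreover have "H v0 \<noteq> - \<infinity>"
        using fin[of i0] i0 I by (auto simp: cell_log_lik_def ext_cdf_def ext_ln_def)
      ultimately obtain c where c: "H v0 = ereal c" "c < - C"
        by (cases "H v0") auto
      \<comment> \<open>The minimum of \<open>S\<close> is the next level of \<open>H\<close> above
        \<open>c\<close>, or \<open>- C\<close> if that comes first; including \<open>- C\<close>
        also keeps the set nonempty.\<close>
      define S where "S = insert (ereal (- C)) {H (v i) | i. i \<in> I \<and> H (v i) > ereal c}"
      have S: "finite S" "S \<noteq> {}"
        unfolding S_def using I by auto
      have "Min S \<le> ereal (- C)" "Min S > ereal c"
        using S c by (auto simp: Min_le_iff S_def)
      then obtain c' where c': "Min S = ereal c'" "c < c'" "c' \<le> - C"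
        by (cases "Min S") auto
      have gap: "ereal c' \<le> H (v i)" if "i \<in> I" "ereal c < H (v i)" for i
        unfolding c'(1)[symmetric] using S that by (intro Min_le) (auto simp: S_def)
      define G where "G t = (if t < v0 then H t else max (H t) (ereal c'))" for t
      have "mono G"
        using H by (fastforce simp: mono_def G_def le_max_iff_disj)
      \<comment> \<open>The part of the sample affected by passing from \<open>H\<close> to
        \<open>G\<close>. Observations at level \<open>c\<close> left of \<open>v0\<close> are
        failures and keep their level.\<close>
      define D where "D = {i \<in> I. v0 \<le> v i \<and> H (v i) = ereal c}"
      have HD: "H (v i) = ereal c" "G (v i) = ereal c'" if "i \<in> D" for i
        using that c' by (auto simp: D_def G_def)
      have G_eq: "G (v i) = H (v i)" if "i \<in> I - D" for i
      proof (cases "v0 \<le> v i")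
        case True
        then have "ereal c < H (v i)"
          using monoD[OF H True] c that by (auto simp: D_def)
        then show ?thesis
          using gap[of i] that by (simp add: G_def max_absorb1)
      qed (simp add: G_def)
      have D: "finite D" "D \<subseteq> I" "i0 \<in> D"
        using I i0 c by (auto simp: D_def)
      define t where "t = Max (v ` D)"
      have "t \<in> v ` D"
        unfolding t_def using D by (intro Max_in) auto
      then have Ht: "H t = ereal c"
        using HD by auto
      have t: "v i \<le> t" if "i \<in> D" for i
        unfolding t_def using D that by (intro Max_ge) auto
      \<comment> \<open>A success up to \<open>t\<close> lies between \<open>v0\<close> and
        \<open>t\<close>, and \<open>H\<close> equals \<open>c\<close> at both ends, so monotonicity
        puts it into \<open>D\<close>. The segment up to \<open>t\<close> may contain further
        failures; these only lower its success fraction, so the bound on that fraction passes to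
        \<open>D\<close>.\<close>
      have sD: "s \<inter> D = {i \<in> s. v i \<le> t}"
      proof (intro equalityI subsetI)
        fix i assume "i \<in> {i \<in> s. v i \<le> t}"
        then show "i \<in> s \<inter> D"
          using v0_le[of i] monoD[OF H, of v0 "v i"] monoD[OF H, of "v i" t] I c Ht by (auto simp: D_def)
      qed (use t in auto)
      have "D \<subseteq> {i \<in> I. v i \<le> t}"
        using D t by auto
      then have "card D \<le> card {i \<in> I. v i \<le> t}"
        using I by (intro card_mono) auto
      then have "\<rho> * card D \<le> \<rho> * card {i \<in> I. v i \<le> t}"
        using assms by simp
      also have "\<dots> \<le> card {i \<in> s. v i \<le> t}"
        using ratio i0 t[OF D(3)] unfolding success_ratio_ge_def by blast
      finally have "\<rho> * card D \<le> card (s \<inter> D)"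
        by (simp add: sD)
      then have "(\<Sum>i\<in>D. cell_log_lik F (i \<in> s \<inter> D) (a i) (ereal c)) <
          (\<Sum>i\<in>D. cell_log_lik F (i \<in> s \<inter> D) (a i) (ereal c'))"
        using D a i0 c' by (intro C[rule_format]) auto
      then have "(\<Sum>i\<in>D. ?l i (H (v i))) < (\<Sum>i\<in>D. ?l i (G (v i)))"
        by (simp add: HD cong: sum.cong)
      moreover have "\<bar>\<Sum>i\<in>I - D. ?l i (H (v i))\<bar> \<noteq> \<infinity>"
        using fin by (auto simp: sum_Inf)
      ultimately have "(\<Sum>i\<in>D. ?l i (H (v i))) + (\<Sum>i\<in>I - D. ?l i (H (v i))) <
          (\<Sum>i\<in>D. ?l i (G (v i))) + (\<Sum>i\<in>I - D. ?l i (H (v i)))"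
        by (cases "\<Sum>i\<in>I - D. ?l i (H (v i))";
            cases "\<Sum>i\<in>D. ?l i (H (v i))"; cases "\<Sum>i\<in>D. ?l i (G (v i))") auto
      moreover have "(\<Sum>i\<in>I - D. ?l i (H (v i))) = (\<Sum>i\<in>I - D. ?l i (G (v i)))"
        by (intro sum.cong) (auto simp: G_eq)
      ultimately have "(\<Sum>i\<in>I. ?l i (H (v i))) < (\<Sum>i\<in>I. ?l i (G (v i)))"
        using sum.subset_diff[OF D(2) I(1), of "\<lambda>i. ?l i (G (v i))"]
          sum.subset_diff[OF D(2) I(1), of "\<lambda>i. ?l i (H (v i))"]
        by (simp add: add.commute)
      then show False
        using opt[OF \<open>mono G\<close>] by simp
    qed
  qed
qed

text \<open>The lower bound is applied to the reflected problem: points \<open>- v\<close>, offsets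
  \<open>- a\<close>, failures as successes, and \<open>- H (- t)\<close> in place of
  \<open>H t\<close>.\<close>

lemma isotonic_mle_upper_bound:
  fixes \<rho> K :: real
  assumes "0 < \<rho>"
  shows "\<exists>C>0. \<forall>I s a v H. finite (I :: 'i set) \<longrightarrow> s \<subseteq> I \<longrightarrow> (\<forall>i\<in>I. \<bar>a i\<bar> \<le> K) \<longrightarrow>
    isotonic_mle F I s a v H \<longrightarrow> success_ratio_ge \<rho> I (I - s) (\<lambda>i. - v i) \<longrightarrow> (\<forall>j\<in>I - s. H (v j) \<le> ereal C)"
proof -
  interpret R: log_concave_cdf "\<lambda>x. 1 - F (- x)" "\<lambda>x. f (- x)" "\<lambda>x. - f' (- x)"
    by (rule reflect)
  obtain C where "0 < C" and C: "\<forall>I s a v H. finite (I :: 'i set) \<longrightarrow> s \<subseteq> I \<longrightarrow> (\<forall>i\<in>I. \<bar>a i\<bar> \<le> K) \<longrightarrow>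
      isotonic_mle (\<lambda>x. 1 - F (- x)) I s a v H \<longrightarrow> success_ratio_ge \<rho> I s v \<longrightarrow> (\<forall>j\<in>s. ereal (- C) \<le> H (v j))"
    using R.isotonic_mle_lower_bound[OF assms, where K = K] by (elim exE conjE)
  show ?thesis
  proof (intro exI[of _ C] conjI allI impI ballI)
    show "0 < C"
      by fact
    fix I s :: "'i set" and a v :: "'i \<Rightarrow> real" and H :: "real \<Rightarrow> ereal" and j
    assume I: "finite I" "s \<subseteq> I" and a: "\<forall>i\<in>I. \<bar>a i\<bar> \<le> K" and mle: "isotonic_mle F I s a v H"
      and ratio: "success_ratio_ge \<rho> I (I - s) (\<lambda>i. - v i)" and j: "j \<in> I - s"
    have "isotonic_mle (\<lambda>x. 1 - F (- x)) I (I - s) (\<lambda>i. - a i) (\<lambda>i. - v i) (\<lambda>t. - H (- t))"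
      unfolding isotonic_mle_def
    proof (intro conjI allI impI)
      have mono_reflect: "mono (\<lambda>t. - G (- t))" if "mono G" for G :: "real \<Rightarrow> ereal"
        using that by (auto simp: mono_def)
      show "mono (\<lambda>t. - H (- t))"
        using mle by (intro mono_reflect) (simp add: isotonic_mle_def)
      have cell: "(\<Sum>i\<in>I. cell_log_lik (\<lambda>x. 1 - F (- x)) (i \<in> I - s) (- a i) (G i)) =
          (\<Sum>i\<in>I. cell_log_lik F (i \<in> s) (a i) (- G i))" for G
        using cell_log_lik_reflect[of F "i \<in> s" "a i" "- G i" for i] by (intro sum.cong) auto
      \<comment> \<open>Reflection is an involution on monotone functions, so a competitor
        \<open>G\<close> of the reflected problem comes from the competitor \<open>- G (- t)\<close>
        of the original one.\<close>
      fix G :: "real \<Rightarrow> ereal" assume "mono G"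
      then have "(\<Sum>i\<in>I. cell_log_lik F (i \<in> s) (a i) (- G (- v i))) \<le>
          (\<Sum>i\<in>I. cell_log_lik F (i \<in> s) (a i) (H (v i)))"
        using mle mono_reflect[of G] unfolding isotonic_mle_def by blast
      then show "(\<Sum>i\<in>I. cell_log_lik (\<lambda>x. 1 - F (- x)) (i \<in> I - s) (- a i) (G (- v i))) \<le>
          (\<Sum>i\<in>I. cell_log_lik (\<lambda>x. 1 - F (- x)) (i \<in> I - s) (- a i) (- H (- (- v i))))"
        unfolding cell by simp
    qed
    then have "ereal (- C) \<le> - H (- (- v j))"
      using I a ratio j by (intro C[rule_format, of I "I - s" "\<lambda>i. - a i" "\<lambda>i. - v i" "\<lambda>t. - H (- t)"]) auto
    then show "H (v j) \<le> ereal C"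
      by (cases "H (v j)") auto
  qed
qed

end

section \<open>Success ratios of initial segments\<close>

text \<open>The Chernoff factor of one observation, 1/2 to the number of successes. With success
  probability \<open>p\<close> its mean is \<open>1 - p / 2\<close>.\<close>

abbreviation success_weight :: "bool \<Rightarrow> ennreal" where
  "success_weight b \<equiv> (if b then ennreal (1/2) else 1)"

text \<open>Given the first coordinate, a success has probability at least \<open>p\<close>, so the
  weight has conditional mean at most \<open>1 - p / 2\<close>. Stating the condition through Borel
  sets \<open>B\<close> avoids kernels.\<close>

lemma nn_integral_success_weight_le:
  fixes \<mu> :: "(real \<times> bool) measure" and p :: real
  assumes sets[measurable_cong]: "sets \<mu> = sets (borel \<Otimes>\<^sub>M count_space UNIV)"
    and "prob_space \<mu>" and p: "0 \<le> p" "p \<le> 1"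
    and success: "\<And>B. B \<in> sets borel \<Longrightarrow> p * measure \<mu> (B \<times> UNIV) \<le> measure \<mu> (B \<times> {True})"
    and [measurable]: "\<psi> \<in> borel_measurable borel"
  shows "(\<integral>\<^sup>+y. \<psi> (fst y) * success_weight (snd y) \<partial>\<mu>) \<le> ennreal (1 - p / 2) * (\<integral>\<^sup>+y. \<psi> (fst y) \<partial>\<mu>)"
proof -
  interpret prob_space \<mu> by fact
  have [simp]: "space \<mu> = UNIV"
    using sets_eq_imp_space_eq[OF sets] by (simp add: space_pair_measure)
  \<comment> \<open>The inequality on Borel sets becomes an order between two measures on the line,
    and hence an inequality for the integral of every \<open>\<psi>\<close>.\<close>
  define N1 where "N1 = distr (density \<mu> (\<lambda>y. success_weight (snd y))) borel fst"
  define N2 where "N2 = scale_measure (ennreal (1 - p / 2)) (distr \<mu> borel fst)"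
  have "N1 \<le> N2"
  proof (subst le_measure)
    show "\<forall>B\<in>sets N1. emeasure N1 B \<le> emeasure N2 B"
    proof
      fix B assume "B \<in> sets N1"
      then have B[measurable]: "B \<in> sets borel"
        by (simp add: N1_def)
      have meas: "B \<times> S \<in> sets \<mu>" for S
        unfolding sets by measurable
      have "emeasure N1 B = (\<integral>\<^sup>+y. success_weight (snd y) * indicator (B \<times> UNIV) y \<partial>\<mu>)"
        unfolding N1_def using meas[of UNIV] by (simp add: emeasure_distr emeasure_density vimage_fst)
      also have "\<dots> = (\<integral>\<^sup>+y. ennreal (1/2) * indicator (B \<times> {True}) y + indicator (B \<times> {False}) y \<partial>\<mu>)"
        by (intro nn_integral_cong) (auto simp: indicator_def)
      also have "\<dots> = ennreal (1/2) * emeasure \<mu> (B \<times> {True}) + emeasure \<mu> (B \<times> {False})"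
        using meas by (simp add: nn_integral_add nn_integral_cmult)
      also have "\<dots> = ennreal (prob (B \<times> {True}) / 2 + prob (B \<times> {False}))"
        by (simp only: emeasure_eq_measure ennreal_mult[symmetric] ennreal_plus[symmetric] measure_nonneg
            mult_nonneg_nonneg zero_le_divide_1_iff zero_le_numeral) simp
      also have "\<dots> \<le> ennreal ((1 - p / 2) * prob (B \<times> UNIV))"
      proof -
        have "B \<times> UNIV = B \<times> {True} \<union> B \<times> {False}"
          by auto
        then have "prob (B \<times> UNIV) = prob (B \<times> {True}) + prob (B \<times> {False})"
          using finite_measure_Union[OF meas meas, of "{True}" "{False}"] by auto
        then show ?thesis
          using success[OF B] by (intro ennreal_leI) (simp add: algebra_simps)
      qed
      also have "\<dots> = emeasure N2 B"
        using p by (simp add: N2_def emeasure_distr emeasure_eq_measure ennreal_mult vimage_fst)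
      finally show "emeasure N1 B \<le> emeasure N2 B" .
    qed
  qed (simp add: N1_def N2_def)
  then have "(\<integral>\<^sup>+v. \<psi> v \<partial>N1) \<le> (\<integral>\<^sup>+v. \<psi> v \<partial>N2)"
    by (intro nn_integral_mono_measure) (simp_all add: N1_def N2_def)
  then show ?thesis
    by (simp add: N1_def N2_def nn_integral_distr nn_integral_density nn_integral_scale_measure mult.commute)
qed

text \<open>The coordinates in \<open>A\<close> are treated one at a time, by induction and Fubini.
  The factor \<open>\<phi>\<close> may couple all first coordinates, so it can be the indicator of
  an ordering event.\<close>

lemma nn_integral_prod_success_weight_le:
  fixes \<mu> :: "(real \<times> bool) measure" and p :: real and \<phi> :: "('i \<Rightarrow> real) \<Rightarrow> ennreal"
  assumes sets[measurable_cong]: "sets \<mu> = sets (borel \<Otimes>\<^sub>M count_space UNIV)"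
    and "prob_space \<mu>" and p: "0 \<le> p" "p \<le> 1"
    and success: "\<And>B. B \<in> sets borel \<Longrightarrow> p * measure \<mu> (B \<times> UNIV) \<le> measure \<mu> (B \<times> {True})"
    and "finite I" and [measurable]: "\<phi> \<in> borel_measurable (Pi\<^sub>M I (\<lambda>_. borel))"
    and "finite A" "A \<subseteq> I"
  shows "(\<integral>\<^sup>+x. \<phi> (\<lambda>i\<in>I. fst (x i)) * (\<Prod>i\<in>A. success_weight (snd (x i))) \<partial>Pi\<^sub>M I (\<lambda>_. \<mu>))
    \<le> ennreal (1 - p / 2) ^ card A * (\<integral>\<^sup>+x. \<phi> (\<lambda>i\<in>I. fst (x i)) \<partial>Pi\<^sub>M I (\<lambda>_. \<mu>))"
  using \<open>finite A\<close> \<open>A \<subseteq> I\<close>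
proof (induction A rule: finite_induct)
  case (insert i A)
  interpret prob_space \<mu> by fact
  interpret product_prob_space "\<lambda>_. \<mu>" ..
  define J where "J = I - {i}"
  have I: "I = insert i J" "finite J" "i \<notin> J" "A \<subseteq> J"
    using insert \<open>finite I\<close> by (auto simp: J_def)
  let ?w = "\<lambda>x. \<Prod>k\<in>A. success_weight (snd (x k))"
  have [measurable]: "(\<lambda>x. x k) \<in> measurable (Pi\<^sub>M I (\<lambda>_. \<mu>)) \<mu>" if "k \<in> I" for k
    using that by simp
  have [measurable]: "(\<lambda>x. success_weight (snd (x k))) \<in> borel_measurable (Pi\<^sub>M I (\<lambda>_. \<mu>))" if "k \<in> I" for k
    using that by measurable
  have [measurable]: "?w \<in> borel_measurable (Pi\<^sub>M I (\<lambda>_. \<mu>))"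
    using I by (intro borel_measurable_prod_ennreal) auto
  have [measurable]: "(\<lambda>x. \<lambda>i\<in>I. fst (x i)) \<in> measurable (Pi\<^sub>M I (\<lambda>_. \<mu>)) (Pi\<^sub>M I (\<lambda>_. borel))"
    by (intro measurable_restrict) measurable
  have split: "(\<integral>\<^sup>+x. F x \<partial>Pi\<^sub>M I (\<lambda>_. \<mu>)) = (\<integral>\<^sup>+x. \<integral>\<^sup>+y. F (x(i := y)) \<partial>\<mu> \<partial>Pi\<^sub>M J (\<lambda>_. \<mu>))"
    if "F \<in> borel_measurable (Pi\<^sub>M I (\<lambda>_. \<mu>))" for F
    using product_nn_integral_insert[OF I(2,3), of F] that I(1) by simp
  have w_upd: "?w (x(i := y)) = ?w x" for x y
    using insert by (intro prod.cong) auto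
  have "(\<integral>\<^sup>+x. \<phi> (\<lambda>i\<in>I. fst (x i)) * (\<Prod>k\<in>insert i A. success_weight (snd (x k))) \<partial>Pi\<^sub>M I (\<lambda>_. \<mu>)) =
      (\<integral>\<^sup>+x. \<phi> (\<lambda>i\<in>I. fst (x i)) * (success_weight (snd (x i)) * ?w x) \<partial>Pi\<^sub>M I (\<lambda>_. \<mu>))"
    using insert by simp
  also have "\<dots> = (\<integral>\<^sup>+x. \<integral>\<^sup>+y. \<phi> (\<lambda>k\<in>I. fst ((x(i := y)) k)) * (success_weight (snd y) * ?w x) \<partial>\<mu> \<partial>Pi\<^sub>M J (\<lambda>_. \<mu>))"
    using insert by (subst split) (simp_all add: w_upd del: fun_upd_apply, simp_all)
  also have "\<dots> \<le> (\<integral>\<^sup>+x. \<integral>\<^sup>+y. ennreal (1 - p / 2) * (\<phi> (\<lambda>k\<in>I. fst ((x(i := y)) k)) * ?w x) \<partial>\<mu> \<partial>Pi\<^sub>M J (\<lambda>_. \<mu>))"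
  proof (rule nn_integral_mono)
    fix x assume x: "x \<in> space (Pi\<^sub>M J (\<lambda>_. \<mu>))"
    \<comment> \<open>With the other coordinates fixed, \<open>\<phi>\<close> depends only on the
      first component of coordinate \<open>i\<close>, and the weights on \<open>A\<close> are
      constants; the one-coordinate bound applies.\<close>
    define \<psi> where "\<psi> v = \<phi> (\<lambda>k\<in>I. if k = i then v else fst (x k))" for v
    have "(\<lambda>v. \<lambda>k\<in>I. if k = i then v else fst (x k)) \<in> measurable borel (Pi\<^sub>M I (\<lambda>_. borel))"
      by (intro measurable_restrict) measurable
    then have [measurable]: "\<psi> \<in> borel_measurable borel"
      unfolding \<psi>_def by measurable
    have \<psi>: "\<phi> (\<lambda>k\<in>I. fst ((x(i := y)) k)) = \<psi> (fst y)" for y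
      unfolding \<psi>_def by (intro arg_cong[where f = \<phi>] restrict_ext) auto
    have "(\<integral>\<^sup>+y. \<psi> (fst y) * (success_weight (snd y) * ?w x) \<partial>\<mu>) =
        ?w x * (\<integral>\<^sup>+y. \<psi> (fst y) * success_weight (snd y) \<partial>\<mu>)"
      by (subst nn_integral_cmult[symmetric]) (auto simp: ac_simps)
    also have "\<dots> \<le> ?w x * (ennreal (1 - p / 2) * (\<integral>\<^sup>+y. \<psi> (fst y) \<partial>\<mu>))"
      by (intro mult_left_mono nn_integral_success_weight_le sets \<open>prob_space \<mu>\<close> p success) auto
    also have "\<dots> = (\<integral>\<^sup>+y. ennreal (1 - p / 2) * (\<psi> (fst y) * ?w x) \<partial>\<mu>)"
      by (subst nn_integral_cmult, measurable, subst nn_integral_multc) (auto simp: ac_simps)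
    finally show "(\<integral>\<^sup>+y. \<phi> (\<lambda>k\<in>I. fst ((x(i := y)) k)) * (success_weight (snd y) * ?w x) \<partial>\<mu>) \<le>
        (\<integral>\<^sup>+y. ennreal (1 - p / 2) * (\<phi> (\<lambda>k\<in>I. fst ((x(i := y)) k)) * ?w x) \<partial>\<mu>)"
      unfolding \<psi> .
  qed
  also have "\<dots> = (\<integral>\<^sup>+x. ennreal (1 - p / 2) * (\<phi> (\<lambda>i\<in>I. fst (x i)) * ?w x) \<partial>Pi\<^sub>M I (\<lambda>_. \<mu>))"
    by (subst split) (simp_all add: w_upd del: fun_upd_apply)
  also have "\<dots> = ennreal (1 - p / 2) * (\<integral>\<^sup>+x. \<phi> (\<lambda>i\<in>I. fst (x i)) * ?w x \<partial>Pi\<^sub>M I (\<lambda>_. \<mu>))"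
    by (intro nn_integral_cmult) measurable
  also have "\<dots> \<le> ennreal (1 - p / 2) * (ennreal (1 - p / 2) ^ card A * (\<integral>\<^sup>+x. \<phi> (\<lambda>i\<in>I. fst (x i)) \<partial>Pi\<^sub>M I (\<lambda>_. \<mu>)))"
    using insert.prems by (intro mult_left_mono insert.IH) auto
  finally show ?case
    by (simp only: card_insert_disjoint[OF insert.hyps] power_Suc mult.assoc)
qed simp

text \<open>A plain union bound over the subsets of \<open>I\<close> would be too crude. Each
  \<open>A\<close> is weighted by the probability that it is a lower set; for each size these add up
  to at most 1, which leaves a geometric series.\<close>

lemma (in prob_space) few_successes_bound:
  fixes Y :: "'i \<Rightarrow> 'a \<Rightarrow> real \<times> bool" and p \<epsilon> :: real and m :: nat
  assumes "finite I" and indep: "indep_vars (\<lambda>_. borel \<Otimes>\<^sub>M count_space UNIV) Y I"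
    and distr: "\<And>i. i \<in> I \<Longrightarrow> distr M (borel \<Otimes>\<^sub>M count_space UNIV) (Y i) = \<mu>"
    and p: "0 \<le> p" "p \<le> 1"
    and success: "\<And>B. B \<in> sets borel \<Longrightarrow> p * measure \<mu> (B \<times> UNIV) \<le> measure \<mu> (B \<times> {True})"
    and q: "q = (1 - p / 2) * 2 powr \<epsilon>" "q < 1"
  defines "lower \<equiv> \<lambda>A \<omega>. \<forall>i\<in>A. \<forall>k\<in>I - A. fst (Y i \<omega>) < fst (Y k \<omega>)"
    and "few \<equiv> \<lambda>A \<omega>. real (card {i \<in> A. snd (Y i \<omega>)}) < \<epsilon> * card A"
  shows "{\<omega> \<in> space M. \<exists>A\<subseteq>I. m \<le> card A \<and> lower A \<omega> \<and> few A \<omega>} \<in> events"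
    and "prob {\<omega> \<in> space M. \<exists>A\<subseteq>I. m \<le> card A \<and> lower A \<omega> \<and> few A \<omega>} \<le> q ^ m / (1 - q)"
proof -
  have Y[measurable]: "random_variable (borel \<Otimes>\<^sub>M count_space UNIV) (Y i)" if "i \<in> I" for i
    using indep that by (simp add: indep_vars_def)
  have q0: "0 < q"
    using p by (simp add: q)
  have lower_event: "{\<omega> \<in> space M. lower A \<omega>} \<in> events" if "A \<subseteq> I" for A
  proof -
    have "finite A"
      using \<open>finite I\<close> that finite_subset by blast
    then show ?thesis
      unfolding lower_def using \<open>finite I\<close> that
      by (intro sets.sets_Collect_finite_All borel_measurable_less) auto
  qed
  have event: "{\<omega> \<in> space M. lower A \<omega> \<and> few A \<omega>} \<in> events" if "A \<subseteq> I" for A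
  proof -
    have "finite A"
      using \<open>finite I\<close> that finite_subset by blast
    then have "real (card {i \<in> A. snd (Y i \<omega>)}) = (\<Sum>i\<in>A. of_bool (snd (Y i \<omega>)))" for \<omega>
      by (simp add: of_bool_def sum.If_cases Int_def)
    moreover have "(\<lambda>\<omega>. \<Sum>i\<in>A. of_bool (snd (Y i \<omega>)) :: real) \<in> borel_measurable M"
      using that by (intro borel_measurable_sum) (auto simp: of_bool_def intro!: measurable_If)
    ultimately have "{\<omega> \<in> space M. few A \<omega>} \<in> events"
      unfolding few_def by simp
    then show ?thesis
      using lower_event[OF that] by (intro sets.sets_Collect_conj)
  qed
  have fin: "finite {A. A \<subseteq> I \<and> P A}" for P
    using \<open>finite I\<close> by simp
  have eq: "{\<omega> \<in> space M. \<exists>A\<subseteq>I. m \<le> card A \<and> lower A \<omega> \<and> few A \<omega>} =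
      (\<Union>A\<in>{A. A \<subseteq> I \<and> m \<le> card A}. {\<omega> \<in> space M. lower A \<omega> \<and> few A \<omega>})"
    by auto
  show "{\<omega> \<in> space M. \<exists>A\<subseteq>I. m \<le> card A \<and> lower A \<omega> \<and> few A \<omega>} \<in> events"
    unfolding eq using event fin by (intro sets.finite_UN) auto
  \<comment> \<open>Exponential Markov inequality on the event that \<open>A\<close> is a lower set.
    That event depends on the first coordinates alone, so each weight still contributes a factor
    \<open>1 - p / 2\<close>.\<close>
  have cell: "prob {\<omega> \<in> space M. lower A \<omega> \<and> few A \<omega>} \<le> q ^ card A * prob {\<omega> \<in> space M. lower A \<omega>}"
    if A: "A \<subseteq> I" for A
  \<comment> \<open>\<open>\<mu>\<close> is tied to the data by an index in \<open>I\<close>;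
    without one it need not be a probability measure.\<close>
  proof (cases "I = {}")
    case True
    then show ?thesis
      using A by (simp add: few_def)
  next
    case False
    then obtain i0 where "i0 \<in> I" by auto
    have "finite A"
      using \<open>finite I\<close> A finite_subset by blast
    have sets_\<mu>[measurable_cong]: "sets \<mu> = sets (borel \<Otimes>\<^sub>M count_space UNIV)"
      using distr[OF \<open>i0 \<in> I\<close>] by auto
    have prob_\<mu>: "prob_space \<mu>"
      using distr[OF \<open>i0 \<in> I\<close>] Y[OF \<open>i0 \<in> I\<close>] prob_space_distr by metis
    let ?P = "Pi\<^sub>M I (\<lambda>_. \<mu>)"
    have R[measurable]: "(\<lambda>\<omega>. \<lambda>i\<in>I. Y i \<omega>) \<in> measurable M ?P"
      by (intro measurable_restrict) (simp add: measurable_cong_sets[OF refl sets_\<mu>] Y)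
    have "?P = (\<Pi>\<^sub>M i\<in>I. distr M (borel \<Otimes>\<^sub>M count_space UNIV) (Y i))"
      by (intro PiM_cong) (auto simp: distr)
    also have "\<dots> = distr M (\<Pi>\<^sub>M i\<in>I. borel \<Otimes>\<^sub>M count_space UNIV) (\<lambda>\<omega>. \<lambda>i\<in>I. Y i \<omega>)"
      using indep_vars_iff_distr_eq_PiM'[OF False Y] indep by simp
    also have "\<dots> = distr M ?P (\<lambda>\<omega>. \<lambda>i\<in>I. Y i \<omega>)"
      by (intro distr_cong sets_PiM_cong) (auto simp: sets_\<mu>)
    finally have P: "?P = distr M ?P (\<lambda>\<omega>. \<lambda>i\<in>I. Y i \<omega>)" .
    define L where "L = {u \<in> space (Pi\<^sub>M I (\<lambda>_. borel :: real measure)). \<forall>i\<in>A. \<forall>k\<in>I - A. u i < u k}"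
    have L[measurable]: "L \<in> sets (Pi\<^sub>M I (\<lambda>_. borel))"
      unfolding L_def using \<open>finite I\<close> \<open>finite A\<close> A
      by (intro sets.sets_Collect_finite_All borel_measurable_less measurable_component_singleton) auto
    have V[measurable]: "(\<lambda>x. \<lambda>i\<in>I. fst (x i)) \<in> measurable ?P (Pi\<^sub>M I (\<lambda>_. borel))"
      by (intro measurable_restrict) measurable
    have L_iff: "indicator L (\<lambda>i\<in>I. fst ((\<lambda>i\<in>I. Y i \<omega>) i)) = (indicator {\<omega> \<in> space M. lower A \<omega>} \<omega> :: ennreal)"
      if "\<omega> \<in> space M" for \<omega>
      using A that by (auto simp: L_def lower_def indicator_def space_PiM subset_eq)
    let ?w = "\<lambda>x. \<Prod>i\<in>A. success_weight (snd (x i))"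
    have w_meas[measurable]: "?w \<in> borel_measurable ?P"
    proof (intro borel_measurable_prod_ennreal)
      fix i assume "i \<in> A"
      then have "i \<in> I"
        using A by auto
      then show "(\<lambda>x. success_weight (snd (x i))) \<in> borel_measurable ?P"
        by measurable
    qed
    \<comment> \<open>On \<open>few\<close> the exponent \<open>\<epsilon> * card A - ?k\<close> is
      positive, so the rescaled weight is at least 1 and dominates the indicator.\<close>
    have w: "1 \<le> ennreal (2 powr (\<epsilon> * card A)) * ?w (\<lambda>i\<in>I. Y i \<omega>)" if "few A \<omega>" for \<omega>
    proof -
      let ?k = "card {i \<in> A. snd (Y i \<omega>)}"
      have "?w (\<lambda>i\<in>I. Y i \<omega>) = (\<Prod>i\<in>A. success_weight (snd (Y i \<omega>)))"
        by (rule prod.cong) (use A in \<open>auto simp: subset_iff\<close>)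
      also have "\<dots> = ennreal (1/2) ^ ?k"
        using \<open>finite A\<close> by (simp add: prod.If_cases Int_def)
      also have "\<dots> = ennreal (2 powr - real ?k)"
        by (subst ennreal_power) (simp_all add: powr_minus powr_realpow power_one_over inverse_eq_divide)
      finally have "ennreal (2 powr (\<epsilon> * card A)) * ?w (\<lambda>i\<in>I. Y i \<omega>) = ennreal (2 powr (\<epsilon> * card A - ?k))"
        by (simp add: ennreal_mult[symmetric] powr_add[symmetric])
      moreover have "(1::real) \<le> 2 powr (\<epsilon> * card A - ?k)"
        using that by (intro ge_one_powr_ge_zero) (auto simp: few_def)
      ultimately show ?thesis
        by simp
    qed
    have "emeasure M {\<omega> \<in> space M. lower A \<omega> \<and> few A \<omega>} =
        (\<integral>\<^sup>+\<omega>. indicator {\<omega> \<in> space M. lower A \<omega> \<and> few A \<omega>} \<omega> \<partial>M)"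
      using event[OF A] by simp
    also have "\<dots> \<le> (\<integral>\<^sup>+\<omega>. indicator L (\<lambda>i\<in>I. fst ((\<lambda>i\<in>I. Y i \<omega>) i)) *
        (ennreal (2 powr (\<epsilon> * card A)) * ?w (\<lambda>i\<in>I. Y i \<omega>)) \<partial>M)"
    proof (intro nn_integral_mono)
      fix \<omega> assume "\<omega> \<in> space M"
      then show "indicator {\<omega> \<in> space M. lower A \<omega> \<and> few A \<omega>} \<omega> \<le>
          indicator L (\<lambda>i\<in>I. fst ((\<lambda>i\<in>I. Y i \<omega>) i)) * (ennreal (2 powr (\<epsilon> * card A)) * ?w (\<lambda>i\<in>I. Y i \<omega>))"
        unfolding L_iff[OF \<open>\<omega> \<in> space M\<close>] using w[of \<omega>] by (auto simp: indicator_def)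
    qed
    also have "\<dots> = (\<integral>\<^sup>+x. indicator L (\<lambda>i\<in>I. fst (x i)) * (ennreal (2 powr (\<epsilon> * card A)) * ?w x) \<partial>?P)"
      by (subst P) (rule nn_integral_distr[symmetric], measurable)
    also have "\<dots> = ennreal (2 powr (\<epsilon> * card A)) * (\<integral>\<^sup>+x. indicator L (\<lambda>i\<in>I. fst (x i)) * ?w x \<partial>?P)"
      by (subst nn_integral_cmult[symmetric]) (auto simp: ac_simps)
    also have "\<dots> \<le> ennreal (2 powr (\<epsilon> * card A)) *
        (ennreal (1 - p / 2) ^ card A * (\<integral>\<^sup>+x. indicator L (\<lambda>i\<in>I. fst (x i)) \<partial>?P))"
      by (intro mult_left_mono nn_integral_prod_success_weight_le sets_\<mu> prob_\<mu> p success
          \<open>finite I\<close> \<open>finite A\<close> A) auto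
    also have "\<dots> = ennreal (q ^ card A) * (\<integral>\<^sup>+x. indicator L (\<lambda>i\<in>I. fst (x i)) \<partial>?P)"
    proof -
      have "2 powr (\<epsilon> * card A) = (2 powr \<epsilon>) ^ card A"
        by (simp add: powr_powr[symmetric] powr_realpow)
      then have "q ^ card A = 2 powr (\<epsilon> * card A) * (1 - p / 2) ^ card A"
        by (simp add: q power_mult_distrib)
      then have "ennreal (q ^ card A) = ennreal (2 powr (\<epsilon> * card A)) * ennreal (1 - p / 2) ^ card A"
        using p by (simp add: ennreal_mult ennreal_power)
      then show ?thesis
        by (simp only: mult.assoc)
    qed
    also have "(\<integral>\<^sup>+x. indicator L (\<lambda>i\<in>I. fst (x i)) \<partial>?P) =
        (\<integral>\<^sup>+\<omega>. indicator L (\<lambda>i\<in>I. fst ((\<lambda>i\<in>I. Y i \<omega>) i)) \<partial>M)"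
      by (subst P) (rule nn_integral_distr, measurable)
    also have "\<dots> = (\<integral>\<^sup>+\<omega>. indicator {\<omega> \<in> space M. lower A \<omega>} \<omega> \<partial>M)"
      by (intro nn_integral_cong L_iff)
    also have "\<dots> = emeasure M {\<omega> \<in> space M. lower A \<omega>}"
      using lower_event[OF A] by simp
    finally show ?thesis
      using q0 by (simp add: emeasure_eq_measure ennreal_mult[symmetric])
  qed
  text \<open>Lower sets form a chain, so at most one of them has a given size.\<close>
  have size: "(\<Sum>A\<in>{A. A \<subseteq> I \<and> card A = k}. prob {\<omega> \<in> space M. lower A \<omega>}) \<le> 1" for k
  proof -
    have "A = B" if "A \<subseteq> I" "B \<subseteq> I" "card A = card B" "lower A \<omega>" "lower B \<omega>" for A B \<omega>
    proof -
      have "A \<subseteq> B \<or> B \<subseteq> A"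
      proof (rule ccontr)
        assume "\<not> ?thesis"
        then obtain i k where "i \<in> A" "i \<notin> B" "k \<in> B" "k \<notin> A"
          by blast
        moreover from this that have "i \<in> I" "k \<in> I"
          by auto
        ultimately have "fst (Y i \<omega>) < fst (Y k \<omega>)" "fst (Y k \<omega>) < fst (Y i \<omega>)"
          using that(4,5) by (simp_all add: lower_def)
        then show False
          by simp
      qed
      then show ?thesis
        using that \<open>finite I\<close> by (metis card_subset_eq finite_subset)
    qed
    then have "disjoint_family_on (\<lambda>A. {\<omega> \<in> space M. lower A \<omega>}) {A. A \<subseteq> I \<and> card A = k}"
      unfolding disjoint_family_on_def by blast
    then have "(\<Sum>A\<in>{A. A \<subseteq> I \<and> card A = k}. prob {\<omega> \<in> space M. lower A \<omega>}) =
        prob (\<Union>A\<in>{A. A \<subseteq> I \<and> card A = k}. {\<omega> \<in> space M. lower A \<omega>})"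
      using lower_event fin by (intro finite_measure_finite_Union[symmetric]) auto
    then show ?thesis
      by simp
  qed
  have "prob {\<omega> \<in> space M. \<exists>A\<subseteq>I. m \<le> card A \<and> lower A \<omega> \<and> few A \<omega>} \<le>
      (\<Sum>A\<in>{A. A \<subseteq> I \<and> m \<le> card A}. prob {\<omega> \<in> space M. lower A \<omega> \<and> few A \<omega>})"
    unfolding eq using event fin by (intro finite_measure_subadditive_finite) auto
  also have "\<dots> \<le> (\<Sum>A\<in>{A. A \<subseteq> I \<and> m \<le> card A}. q ^ card A * prob {\<omega> \<in> space M. lower A \<omega>})"
    by (intro sum_mono cell) auto
  also have "\<dots> = (\<Sum>k\<in>{m..card I}. \<Sum>A\<in>{A. A \<subseteq> I \<and> card A = k}. q ^ card A * prob {\<omega> \<in> space M. lower A \<omega>})"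
    by (subst sum.group[symmetric, of _ "{m..card I}" card])
      (use fin \<open>finite I\<close> in \<open>auto simp: card_mono intro!: sum.cong\<close>)
  also have "\<dots> = (\<Sum>k\<in>{m..card I}. q ^ k * (\<Sum>A\<in>{A. A \<subseteq> I \<and> card A = k}. prob {\<omega> \<in> space M. lower A \<omega>}))"
    by (simp add: sum_distrib_left)
  also have "\<dots> \<le> (\<Sum>k\<in>{m..card I}. q ^ k)"
    using size q0 by (intro sum_mono) (simp add: mult_left_le)
  also have "\<dots> \<le> q ^ m / (1 - q)"
    using q0 q(2) by (simp add: sum_gp divide_right_mono)
  finally show "prob {\<omega> \<in> space M. \<exists>A\<subseteq>I. m \<le> card A \<and> lower A \<omega> \<and> few A \<omega>} \<le> q ^ m / (1 - q)" .
qed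

text \<open>The fraction \<open>\<rho>\<close> depends only on \<open>p\<close> and
  \<open>\<eta>\<close>, not on the sample size or the law. Long initial segments are controlled by
  the Chernoff bound; in short ones a single success is already a fixed fraction.\<close>

lemma success_ratio_bound:
  fixes p \<eta> :: real
  assumes p: "0 < p" "p \<le> 1" and "0 < \<eta>"
  obtains \<rho> :: real where "0 < \<rho>"
    "\<And>M I Y \<mu>. prob_space M \<Longrightarrow> finite I \<Longrightarrow>
      prob_space.indep_vars M (\<lambda>_. borel \<Otimes>\<^sub>M count_space UNIV) Y I \<Longrightarrow>
      (\<And>i. i \<in> I \<Longrightarrow> distr M (borel \<Otimes>\<^sub>M count_space UNIV) (Y i) = \<mu>) \<Longrightarrow>
      (\<And>B. B \<in> sets borel \<Longrightarrow> p * measure \<mu> (B \<times> UNIV) \<le> measure \<mu> (B \<times> {True})) \<Longrightarrow>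
      \<exists>E\<in>sets M. measure M E < \<eta> \<and> (\<forall>\<omega>\<in>space M - E.
        success_ratio_ge \<rho> I {i \<in> I. snd (Y i \<omega>)} (\<lambda>i. fst (Y (i::'i) (\<omega>::'a))))"
proof -
  define r where "r = 1 - p / 2"
  have r: "0 < r" "r < 1"
    using p by (auto simp: r_def)
  \<comment> \<open>Makes \<open>2 powr \<epsilon>\<close> the inverse square root of
    \<open>r\<close>, so that \<open>q\<close> is the square root of \<open>r\<close> and less than
    1.\<close>
  define \<epsilon> where "\<epsilon> = log 2 (1 / r) / 2"
  define q where "q = r * 2 powr \<epsilon>"
  have "2 powr \<epsilon> * 2 powr \<epsilon> = 1 / r"
    using r by (simp add: \<epsilon>_def powr_add[symmetric])
  then have "q * q = r"
    using r by (simp add: q_def field_simps)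
  then have "q < 1"
    using r mult_mono[of 1 q 1 q] by (cases "q < 1") auto
  then have q: "0 < q" "q < 1"
    using r by (auto simp: q_def)
  have \<epsilon>: "0 < \<epsilon>"
    using r by (simp add: \<epsilon>_def)
  \<comment> \<open>Makes the geometric tail \<open>q ^ m / (1 - q)\<close> smaller than
    \<open>\<eta>\<close>.\<close>
  obtain m where m: "q ^ m < \<eta> * (1 - q)"
    using real_arch_pow_inv[of "\<eta> * (1 - q)" q] q \<open>0 < \<eta>\<close> by auto
  \<comment> \<open>The first entry serves segments of size at least \<open>m\<close>, the second
    smaller ones that contain a success.\<close>
  define \<rho> where "\<rho> = min \<epsilon> (1 / real (Suc m))"
  show ?thesis
  proof (rule that)
    show \<rho>: "0 < \<rho>"
      using \<epsilon> by (simp add: \<rho>_def)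
    fix M :: "'a measure" and I :: "'i set" and Y :: "'i \<Rightarrow> 'a \<Rightarrow> real \<times> bool" and \<mu>
    assume "prob_space M" "finite I"
      and indep: "prob_space.indep_vars M (\<lambda>_. borel \<Otimes>\<^sub>M count_space UNIV) Y I"
      and distr: "\<And>i. i \<in> I \<Longrightarrow> distr M (borel \<Otimes>\<^sub>M count_space UNIV) (Y i) = \<mu>"
      and success: "\<And>B. B \<in> sets borel \<Longrightarrow> p * measure \<mu> (B \<times> UNIV) \<le> measure \<mu> (B \<times> {True})"
    interpret prob_space M by fact
    let ?E = "{\<omega> \<in> space M. \<exists>A\<subseteq>I. m \<le> card A \<and> (\<forall>i\<in>A. \<forall>k\<in>I - A. fst (Y i \<omega>) < fst (Y k \<omega>)) \<and>
      real (card {i \<in> A. snd (Y i \<omega>)}) < \<epsilon> * card A}"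
    note bound = few_successes_bound[OF \<open>finite I\<close> indep distr _ p(2) success, of q \<epsilon> m]
    have "?E \<in> events"
      using p q by (intro bound) (auto simp: q_def r_def)
    moreover have "prob ?E \<le> q ^ m / (1 - q)"
      using p q by (intro bound) (auto simp: q_def r_def)
    then have "prob ?E < \<eta>"
      using m q by (simp add: pos_le_divide_eq) (smt (verit) mult_less_cancel_right_pos)
    moreover have "success_ratio_ge \<rho> I {i \<in> I. snd (Y i \<omega>)} (\<lambda>i. fst (Y i \<omega>))"
      if \<omega>: "\<omega> \<in> space M - ?E" for \<omega>
      unfolding success_ratio_ge_def
    proof (intro allI impI)
      fix t
      let ?A = "{i \<in> I. fst (Y i \<omega>) \<le> t}"
      have S: "{i \<in> {i \<in> I. snd (Y i \<omega>)}. fst (Y i \<omega>) \<le> t} = {i \<in> ?A. snd (Y i \<omega>)}"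
        by auto
      assume "{i \<in> {i \<in> I. snd (Y i \<omega>)}. fst (Y i \<omega>) \<le> t} \<noteq> {}"
      then have ne: "{i \<in> ?A. snd (Y i \<omega>)} \<noteq> {}"
        unfolding S .
      show "\<rho> * card ?A \<le> card {i \<in> {i \<in> I. snd (Y i \<omega>)}. fst (Y i \<omega>) \<le> t}"
        unfolding S
      proof (cases "m \<le> card ?A")
        case True
        have "?A \<subseteq> I" "\<forall>i\<in>?A. \<forall>k\<in>I - ?A. fst (Y i \<omega>) < fst (Y k \<omega>)"
          by auto
        then have "\<not> real (card {i \<in> ?A. snd (Y i \<omega>)}) < \<epsilon> * card ?A"
          using \<omega> True by blast
        moreover have "\<rho> * card ?A \<le> \<epsilon> * card ?A"
          by (intro mult_right_mono) (auto simp: \<rho>_def)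
        ultimately show "\<rho> * card ?A \<le> card {i \<in> ?A. snd (Y i \<omega>)}"
          by linarith
      next
        case False
        have "\<rho> * card ?A \<le> 1 / real (Suc m) * real (Suc m)"
          using False \<rho> by (intro mult_mono) (auto simp: \<rho>_def)
        also have "\<dots> \<le> real (card {i \<in> ?A. snd (Y i \<omega>)})"
          using ne \<open>finite I\<close> by (simp add: Suc_le_eq card_gt_0_iff)
        finally show "\<rho> * card ?A \<le> card {i \<in> ?A. snd (Y i \<omega>)}" .
      qed
    qed
    ultimately show "\<exists>E\<in>sets M. measure M E < \<eta> \<and> (\<forall>\<omega>\<in>space M - E.
        success_ratio_ge \<rho> I {i \<in> I. snd (Y i \<omega>)} (\<lambda>i. fst (Y i \<omega>)))"
      by blast
  qed
qed

section \<open>Supports and conditional independence\<close>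

text \<open>The complement of the support is a union of open null sets, and by Lindelof countably
  many of them cover it.\<close>

lemma AE_measure_support:
  fixes N :: "'b::second_countable_topology measure"
  assumes "sets N = sets borel"
  shows "AE x in N. x \<in> measure_support N"
proof -
  define \<F> where "\<F> = {S. open S \<and> emeasure N S = 0}"
  obtain \<G> where \<G>: "\<G> \<subseteq> \<F>" "countable \<G>" "\<Union>\<G> = \<Union>\<F>"
    by (rule Lindelof[of \<F>]) (auto simp: \<F>_def)
  have "\<Union>\<G> \<in> null_sets N"
    using \<G>(1) assms by (intro null_sets_UN'[of \<G> id, simplified] \<G>(2)) (auto simp: \<F>_def null_sets_def)
  then have "AE x in N. x \<notin> \<Union>\<G>"
    by (rule AE_not_in)
  then show ?thesis
    unfolding \<G>(3) by eventually_elim (auto simp: measure_support_def \<F>_def zero_less_iff_neq_zero)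
qed

context prob_space
begin

lemma AE_in_measure_support_distr:
  fixes V :: "'a \<Rightarrow> 'b::second_countable_topology"
  assumes "random_variable borel V"
  shows "AE \<omega> in M. V \<omega> \<in> measure_support (distr M borel V)"
  using AE_distrD[OF assms AE_measure_support] by simp

context
  fixes Y :: "'a \<Rightarrow> 'b::topological_space"
  assumes Y: "random_variable borel Y"
begin

lemma finite_measure_subalgebra_generated: "finite_measure_subalgebra M (generated_algebra M Y)"
proof
  show "subalgebra M (generated_algebra M Y)"
    unfolding subalgebra_def generated_algebra_def
    using Y by (auto simp: sets_vimage_algebra2 measurable_def)
qed

interpretation finite_measure_subalgebra M "generated_algebra M Y"
  by (rule finite_measure_subalgebra_generated)

lemma integrable_cond_prob_event: "E \<in> events \<Longrightarrow> integrable M (cond_prob_event M E Y)"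
  unfolding cond_prob_event_def cond_exp_def by (intro real_cond_exp_int) (simp add: emeasure_eq_measure)

lemma integral_cond_prob_event: "E \<in> events \<Longrightarrow> (\<integral>\<omega>. cond_prob_event M E Y \<omega> \<partial>M) = prob E"
  unfolding cond_prob_event_def cond_exp_def
  by (subst real_cond_exp_int) (simp_all add: emeasure_eq_measure)

lemma cond_prob_event_nonneg: "E \<in> events \<Longrightarrow> AE \<omega> in M. 0 \<le> cond_prob_event M E Y \<omega>"
  unfolding cond_prob_event_def cond_exp_def by (intro real_cond_exp_pos) auto

lemma cond_prob_event_mono:
  assumes "E \<in> events" "E' \<in> events" "AE \<omega> in M. \<omega> \<in> E \<longrightarrow> \<omega> \<in> E'"
  shows "AE \<omega> in M. cond_prob_event M E Y \<omega> \<le> cond_prob_event M E' Y \<omega>"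
  unfolding cond_prob_event_def cond_exp_def
proof (intro real_cond_exp_mono)
  show "AE \<omega> in M. indicat_real E \<omega> \<le> indicat_real E' \<omega>"
    using assms(3) by eventually_elim (auto simp: indicator_def)
qed (use assms in \<open>auto simp: emeasure_eq_measure\<close>)

context
  fixes U V :: "'a \<Rightarrow> real" and A B :: "real set" and c :: real
  assumes indep: "cond_indep M U V Y"
    and [measurable]: "random_variable borel U" "random_variable borel V" "A \<in> sets borel" "B \<in> sets borel"
begin

text \<open>The conditional independence identity is integrated. The product is integrable because
  it agrees almost everywhere with a conditional probability.\<close>

lemma prob_cond_indep:
  "integrable M (\<lambda>\<omega>. cond_prob_event M {\<omega> \<in> space M. U \<omega> \<in> A} Y \<omega> * cond_prob_event M {\<omega> \<in> space M. V \<omega> \<in> B} Y \<omega>)"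
  "prob {\<omega> \<in> space M. U \<omega> \<in> A \<and> V \<omega> \<in> B} =
    (\<integral>\<omega>. cond_prob_event M {\<omega> \<in> space M. U \<omega> \<in> A} Y \<omega> * cond_prob_event M {\<omega> \<in> space M. V \<omega> \<in> B} Y \<omega> \<partial>M)"
proof -
  have meas: "cond_prob_event M E Y \<in> borel_measurable M" for E
    unfolding cond_prob_event_def cond_exp_def by simp
  have E: "{\<omega> \<in> space M. U \<omega> \<in> A \<and> V \<omega> \<in> B} \<in> events"
    by measurable
  have ae: "AE \<omega> in M. cond_prob_event M {\<omega> \<in> space M. U \<omega> \<in> A \<and> V \<omega> \<in> B} Y \<omega> =
      cond_prob_event M {\<omega> \<in> space M. U \<omega> \<in> A} Y \<omega> * cond_prob_event M {\<omega> \<in> space M. V \<omega> \<in> B} Y \<omega>"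
    using indep by (auto simp: cond_indep_def)
  show "integrable M (\<lambda>\<omega>. cond_prob_event M {\<omega> \<in> space M. U \<omega> \<in> A} Y \<omega> * cond_prob_event M {\<omega> \<in> space M. V \<omega> \<in> B} Y \<omega>)"
    using integrable_cond_prob_event[OF E] ae meas by (subst integrable_cong_AE[symmetric]) (auto intro: borel_measurable_times)
  show "prob {\<omega> \<in> space M. U \<omega> \<in> A \<and> V \<omega> \<in> B} =
    (\<integral>\<omega>. cond_prob_event M {\<omega> \<in> space M. U \<omega> \<in> A} Y \<omega> * cond_prob_event M {\<omega> \<in> space M. V \<omega> \<in> B} Y \<omega> \<partial>M)"
    unfolding integral_cond_prob_event[OF E, symmetric]
    using ae meas by (intro integral_cong_AE) auto
qed

text \<open>The constant \<open>c\<close> bounds the conditional probability of the event on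
  \<open>U\<close> from below, and conditional independence lets it be multiplied by that of the
  event on \<open>V\<close> before integrating. In the application \<open>E\<close> is an event on
  the error.\<close>

lemma cond_indep_prob_ge:
  assumes E: "E \<in> events" "AE \<omega> in M. cond_prob_event M E Y \<omega> = c" "AE \<omega> in M. \<omega> \<in> E \<longrightarrow> U \<omega> \<in> A"
  shows "c * prob {\<omega> \<in> space M. V \<omega> \<in> B} \<le> prob {\<omega> \<in> space M. U \<omega> \<in> A \<and> V \<omega> \<in> B}"
proof -
  have "AE \<omega> in M. cond_prob_event M E Y \<omega> \<le> cond_prob_event M {\<omega> \<in> space M. U \<omega> \<in> A} Y \<omega>"
    using E by (intro cond_prob_event_mono) auto
  moreover have "AE \<omega> in M. 0 \<le> cond_prob_event M {\<omega> \<in> space M. V \<omega> \<in> B} Y \<omega>"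
    by (intro cond_prob_event_nonneg) measurable
  ultimately have "(\<integral>\<omega>. c * cond_prob_event M {\<omega> \<in> space M. V \<omega> \<in> B} Y \<omega> \<partial>M) \<le>
      (\<integral>\<omega>. cond_prob_event M {\<omega> \<in> space M. U \<omega> \<in> A} Y \<omega> * cond_prob_event M {\<omega> \<in> space M. V \<omega> \<in> B} Y \<omega> \<partial>M)"
    using E(2)
    by (intro integral_mono_AE prob_cond_indep integrable_mult_right integrable_cond_prob_event)
      (auto intro: mult_right_mono)
  then show ?thesis
    by (simp add: prob_cond_indep integral_cond_prob_event)
qed

lemma cond_indep_prob_le:
  assumes E: "E \<in> events" "AE \<omega> in M. cond_prob_event M E Y \<omega> = c" "AE \<omega> in M. U \<omega> \<in> A \<longrightarrow> \<omega> \<in> E"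
  shows "prob {\<omega> \<in> space M. U \<omega> \<in> A \<and> V \<omega> \<in> B} \<le> c * prob {\<omega> \<in> space M. V \<omega> \<in> B}"
proof -
  have "AE \<omega> in M. cond_prob_event M {\<omega> \<in> space M. U \<omega> \<in> A} Y \<omega> \<le> cond_prob_event M E Y \<omega>"
    using E by (intro cond_prob_event_mono) auto
  moreover have "AE \<omega> in M. 0 \<le> cond_prob_event M {\<omega> \<in> space M. V \<omega> \<in> B} Y \<omega>"
    by (intro cond_prob_event_nonneg) measurable
  ultimately have "(\<integral>\<omega>. cond_prob_event M {\<omega> \<in> space M. U \<omega> \<in> A} Y \<omega> * cond_prob_event M {\<omega> \<in> space M. V \<omega> \<in> B} Y \<omega> \<partial>M) \<le>
      (\<integral>\<omega>. c * cond_prob_event M {\<omega> \<in> space M. V \<omega> \<in> B} Y \<omega> \<partial>M)"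
    using E(2)
    by (intro integral_mono_AE prob_cond_indep integrable_mult_right integrable_cond_prob_event)
      (auto intro: mult_right_mono)
  then show ?thesis
    by (simp add: prob_cond_indep integral_cond_prob_event)
qed

end

end

text \<open>Taking expectations removes the conditioning, so the nonrandom \<open>F\<close> is the
  unconditional distribution function of \<open>e\<close>.\<close>

lemma cond_cdf:
  fixes Y :: "'a \<Rightarrow> 'b::topological_space" and e :: "'a \<Rightarrow> real"
  assumes Y: "random_variable borel Y" and e[measurable]: "random_variable borel e"
    and F: "\<And>t. AE \<omega> in M. cond_prob_event M {\<omega> \<in> space M. e \<omega> \<le> t} Y \<omega> = F t"
  shows "mono F" "(F \<longlongrightarrow> 0) at_bot" "(F \<longlongrightarrow> 1) at_top"
proof -
  interpret D: real_distribution "distr M borel e"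
    by (rule real_distribution_distr) fact
  have "F = cdf (distr M borel e)"
  proof
    fix t
    have "(\<integral>\<omega>. cond_prob_event M {\<omega> \<in> space M. e \<omega> \<le> t} Y \<omega> \<partial>M) = (\<integral>\<omega>. F t \<partial>M)"
      by (intro integral_cong_AE F) (simp_all add: cond_prob_event_def cond_exp_def)
    then have "prob {\<omega> \<in> space M. e \<omega> \<le> t} = F t"
      by (subst (asm) integral_cond_prob_event[OF Y]) (simp_all add: prob_space)
    then show "F t = cdf (distr M borel e) t"
      by (simp add: cdf_def measure_distr vimage_def Int_def conj_commute)
  qed
  then show "mono F" "(F \<longlongrightarrow> 0) at_bot" "(F \<longlongrightarrow> 1) at_top"
    using D.cdf_nondecreasing D.cdf_lim_at_bot D.cdf_lim_at_top_prob by (auto simp: mono_def)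
qed

end

section \<open>Boundedness of the modified estimator\<close>

text \<open>The modified estimator returns 0 or a value of \<open>H\<close> between the ordered
  points number \<open>k\<close> and \<open>l\<close>. The left one is a success and the right one a
  failure, so monotonicity carries the lower bound forward and the upper bound back.\<close>

lemma modified_H_bounds:
  assumes sorts: "sorts_sample n x \<sigma>" and \<delta>: "\<And>i. i \<in> {1..n} \<Longrightarrow> obs_\<delta> (x i) \<in> {0, 1}"
    and H: "mono H" and C: "0 \<le> C"
    and lower: "\<And>i. i \<in> {1..n} \<Longrightarrow> obs_\<delta> (x i) = 1 \<Longrightarrow> ereal (- C) \<le> H (obs_v (x i))"
    and upper: "\<And>i. i \<in> {1..n} \<Longrightarrow> obs_\<delta> (x i) = 0 \<Longrightarrow> H (obs_v (x i)) \<le> ereal C"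
  shows "\<bar>modified_H lv n x \<sigma> H t\<bar> \<le> ereal C"
proof (cases "\<exists>j\<in>{1..<n}. obs_\<delta> (x (\<sigma> j)) = 1 \<and> obs_\<delta> (x (\<sigma> (j + 1))) = 0")
  case True
  then obtain j where j: "j \<in> {1..<n}" "obs_\<delta> (x (\<sigma> j)) = 1" "obs_\<delta> (x (\<sigma> (j + 1))) = 0"
    by auto
  let ?K = "{j \<in> {1..n}. obs_\<delta> (x (\<sigma> j)) = 1}" and ?L = "{j \<in> {1..n}. obs_\<delta> (x (\<sigma> j)) = 0}"
  define k l where "k = Inf ?K" and "l = Sup ?L"
  have K: "j \<in> ?K" and L: "j + 1 \<in> ?L"
    using j by auto
  \<comment> \<open>A success at \<open>j\<close> directly followed by a failure gives
    \<open>k \<le> j < l\<close>, so the two end points are in order.\<close>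
  have k: "k \<in> ?K" "k \<le> j"
    unfolding k_def using Inf_nat_def1[of ?K] K cInf_lower[OF K] by blast+
  have finL: "finite ?L"
    by simp
  have l: "l \<in> ?L" "j + 1 \<le> l"
  proof -
    have "l = Max ?L"
      unfolding l_def using L by (intro cSup_eq_Max finL) blast
    then show "l \<in> ?L" "j + 1 \<le> l"
      using Max_in[OF finL] Max_ge[OF finL L] L by (blast, simp)
  qed
  have perm: "\<sigma> i \<in> {1..n}" if "i \<in> {1..n}" for i
    using sorts that by (simp add: sorts_sample_def permutes_in_image del: atLeastAtMost_iff)
  have le: "obs_v (x (\<sigma> k)) \<le> obs_v (x (\<sigma> l))"
    using sorts k l by (auto simp: sorts_sample_def)
  have bounds: "ereal (- C) \<le> H (obs_v (x (\<sigma> k)))" "H (obs_v (x (\<sigma> l))) \<le> ereal C"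
    using lower[OF perm] upper[OF perm] k l by auto
  have "ereal (- C) \<le> H s \<and> H s \<le> ereal C" if "obs_v (x (\<sigma> k)) \<le> s" "s \<le> obs_v (x (\<sigma> l))" for s
    using bounds monoD[OF H that(1)] monoD[OF H that(2)] by (meson order.trans)
  then have "ereal (- C) \<le> modified_H lv n x \<sigma> H t \<and> modified_H lv n x \<sigma> H t \<le> ereal C"
    using le True unfolding modified_H_def Let_def k_def[symmetric] l_def[symmetric] by simp
  then show ?thesis
    by (cases "modified_H lv n x \<sigma> H t") auto
next
  case False
  then have "modified_H lv n x \<sigma> H t = 0"
    unfolding modified_H_def Let_def by (rule if_not_P)
  then show ?thesis
    using C by simp
qed

text \<open>Competitors that keep \<open>\<beta>\<close> and \<open>h\<close> stay admissible and
  carry the same penalty, so joint maximality restricts to maximality in the monotone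
  component.\<close>

lemma is_MPLE_imp_isotonic_mle:
  assumes mple: "is_MPLE F B0 c0 a b \<nu> n x lam \<beta> h H" and "1 \<le> n"
    and \<delta>: "\<And>i. i \<in> {1..n} \<Longrightarrow> obs_\<delta> (x i) \<in> {0, 1}"
  defines "s \<equiv> {i \<in> {1..n}. obs_\<delta> (x i) = 1}"
    and "\<theta> \<equiv> \<lambda>i. \<beta> \<bullet> fst (snd (snd (x i))) + h (obs_w (x i))"
  shows "isotonic_mle F {1..n} s \<theta> (\<lambda>i. obs_v (x i)) H"
  unfolding isotonic_mle_def
proof (intro conjI allI impI)
  show "mono H"
    using mple by (simp add: is_MPLE_def admissible_def)
  have ll: "(\<Sum>i\<in>{1..n}. log_lik F (x i) \<beta> h G) = (\<Sum>i\<in>{1..n}. cell_log_lik F (i \<in> s) (\<theta> i) (G (obs_v (x i))))" for G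
  proof (rule sum.cong)
    fix i assume i: "i \<in> {1..n}"
    then show "log_lik F (x i) \<beta> h G = cell_log_lik F (i \<in> s) (\<theta> i) (G (obs_v (x i)))"
      using \<delta>[OF i] by (cases "x i")
        (auto simp: log_lik_def cell_log_lik_def s_def \<theta>_def obs_v_def obs_\<delta>_def obs_w_def Let_def
          zero_ereal_def[symmetric] one_ereal_def[symmetric])
  qed simp
  \<comment> \<open>The penalty is a finite real and the factor is positive, so cancellation is
    valid in \<open>ereal\<close> even for infinite likelihoods.\<close>
  have cancel: "X \<le> X'" if "ereal c * X - ereal P \<le> ereal c * X' - ereal P" "0 < c" for c P :: real and X X'
    using that by (cases X; cases X') auto
  fix G :: "real \<Rightarrow> ereal" assume "mono G"
  then have "admissible B0 c0 a b \<nu> n x \<beta> h G"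
    using mple by (simp add: is_MPLE_def admissible_def)
  then have "pen_log_lik F a b \<nu> n x lam \<beta> h G \<le> pen_log_lik F a b \<nu> n x lam \<beta> h H"
    using mple by (simp add: is_MPLE_def)
  then show "(\<Sum>i\<in>{1..n}. cell_log_lik F (i \<in> s) (\<theta> i) (G (obs_v (x i)))) \<le>
      (\<Sum>i\<in>{1..n}. cell_log_lik F (i \<in> s) (\<theta> i) (H (obs_v (x i))))"
    unfolding pen_log_lik_def ll by (rule cancel) (use \<open>1 \<le> n\<close> in simp)
qed

theorem theorem2:
  fixes M :: "'a measure"
    and U V W e :: "'a \<Rightarrow> real" and Z :: "'a \<Rightarrow> real^'d"
    and X :: "nat \<Rightarrow> 'a \<Rightarrow> 'd obs"
    and \<nu> :: nat
    and a b lv uv c0 :: real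
    and \<Z> B0 :: "(real^'d) set"
    and F f f' h0 H0 :: "real \<Rightarrow> real"
    and \<beta>0 :: "real^'d"
    and lam :: "nat \<Rightarrow> 'a \<Rightarrow> real"
    and \<beta>hat :: "nat \<Rightarrow> 'a \<Rightarrow> real^'d"
    and hhat :: "nat \<Rightarrow> 'a \<Rightarrow> real \<Rightarrow> real"
    and Hhat :: "nat \<Rightarrow> 'a \<Rightarrow> real \<Rightarrow> ereal"
    and \<sigma> :: "nat \<Rightarrow> 'a \<Rightarrow> nat \<Rightarrow> nat"
  assumes prob: "prob_space M"
    and rv: "U \<in> borel_measurable M" "V \<in> borel_measurable M" "Z \<in> borel_measurable M"
      "W \<in> borel_measurable M" "e \<in> borel_measurable M"
    and iid: "\<And>i. i \<ge> 1 \<Longrightarrow> X i \<in> borel_measurable M"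
      "prob_space.indep_vars M (\<lambda>_. borel) X {1..}"
      "\<And>i. i \<ge> 1 \<Longrightarrow> distr M borel (X i) =
         distr M borel (\<lambda>\<omega>. (V \<omega>, of_bool (U \<omega> \<le> V \<omega>), Z \<omega>, W \<omega>))"
    and nu: "\<nu> \<ge> 1"
    and A1a: "bounded \<Z>" "AE \<omega> in M. Z \<omega> \<in> \<Z>"
    and A1b: "a < b" "measure_support (distr M borel W) = {a..b}"
    and A1c: "lv < uv" "measure_support (distr M borel V) = {lv..uv}"
    and A2: "pos_def_matrix (expected_cond_var M Z (\<lambda>\<omega>. (V \<omega>, W \<omega>)))"
    and A3: "cond_distr_dominates M W V"
    and A4: "cond_indep M U V (\<lambda>\<omega>. (Z \<omega>, W \<omega>))"
    and B1: "AE \<omega> in M. H0 (U \<omega>) = - (\<beta>0 \<bullet> Z \<omega>) - h0 (W \<omega>) + e \<omega>"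
      "\<And>t. AE \<omega> in M. cond_prob_event M {\<omega> \<in> space M. e \<omega> \<le> t} (\<lambda>\<omega>. (Z \<omega>, W \<omega>)) \<omega> = F t"
    and B2: "bounded B0" "open B0" "\<beta>0 \<in> B0"
    and B3: "h0 \<in> sobolev_class_centered M W a b \<nu> c0"
    and B4: "strict_mono H0" "\<And>K. compact K \<Longrightarrow> bounded (H0 ` K)"
    and B5b: "\<And>t. (F has_real_derivative f t) (at t)" "\<And>t. (f has_real_derivative f' t) (at t)"
      "closure {t. f t \<noteq> 0} = UNIV" "bounded (range f')"
    and B5c: "holder_quantile_condition F"
    and B5d: "\<And>t. min ((f t)\<^sup>2 - f' t * F t) ((f t)\<^sup>2 + f' t * (1 - F t)) > 0"
    and C: "\<And>n \<omega>. n \<ge> 1 \<Longrightarrow> \<omega> \<in> space M \<Longrightarrow> lam n \<omega> > 0"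
      "bounded_in_prob M (\<lambda>n \<omega>. ereal (lam n \<omega>)) (\<lambda>n. real n powr (-1/3))"
      "bounded_in_prob M (\<lambda>n \<omega>. ereal (inverse (lam n \<omega>))) (\<lambda>n. real n powr (1/3))"
    and MPLE: "\<And>n. n \<ge> 1 \<Longrightarrow> AE \<omega> in M.
      is_MPLE F B0 c0 a b \<nu> n (\<lambda>i. X i \<omega>) (lam n \<omega>) (\<beta>hat n \<omega>) (hhat n \<omega>) (Hhat n \<omega>)"
    and order: "\<And>n \<omega>. n \<ge> 1 \<Longrightarrow> \<omega> \<in> space M \<Longrightarrow> sorts_sample n (\<lambda>i. X i \<omega>) (\<sigma> n \<omega>)"
  shows "bounded_in_prob M
    (\<lambda>n \<omega>. max \<bar>modified_H lv n (\<lambda>i. X i \<omega>) (\<sigma> n \<omega>) (Hhat n \<omega>) lv\<bar>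
               \<bar>modified_H lv n (\<lambda>i. X i \<omega>) (\<sigma> n \<omega>) (Hhat n \<omega>) uv\<bar>)
    (\<lambda>n. 1)"
proof -
  interpret prob_space M by (rule prob)
  note [measurable] = rv
  let ?T = "\<lambda>\<omega>. (V \<omega>, of_bool (U \<omega> \<le> V \<omega>) :: real, Z \<omega>, W \<omega>)"
  have ZW: "(\<lambda>\<omega>. (Z \<omega>, W \<omega>)) \<in> borel_measurable M"
    by (intro borel_measurable_Pair rv)
  have T: "?T \<in> borel_measurable M"
    by (intro borel_measurable_Pair rv) (simp add: of_bool_def)
  interpret log_concave_cdf F f f'
  proof
    show "mono F" "(F \<longlongrightarrow> 0) at_bot" "(F \<longlongrightarrow> 1) at_top"
      using cond_cdf[OF ZW rv(5) B1(2)] by auto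
    show "f' t * F t < (f t)\<^sup>2" "0 < (f t)\<^sup>2 + f' t * (1 - F t)" for t
      using B5d[of t] by auto
  qed (use B5b in auto)

  \<comment> \<open>Uniform bounds on the index\<close>
  obtain RZ where RZ: "\<And>z. z \<in> \<Z> \<Longrightarrow> norm z \<le> RZ"
    using A1a(1) by (auto simp: bounded_iff)
  obtain RB where RB: "\<And>\<beta>. \<beta> \<in> closure B0 \<Longrightarrow> norm \<beta> \<le> RB"
    using bounded_closure[OF B2(1)] by (auto simp: bounded_iff)
  \<comment> \<open>One bound serves the estimators, with \<open>\<beta>\<close> in the closure of
    \<open>B0\<close> and \<open>h\<close> bounded by \<open>c0\<close>, and the true
    parameters.\<close>
  define K where "K = RB * RZ + c0"
  have index_bound: "\<bar>\<beta> \<bullet> z + y\<bar> \<le> K" if "\<beta> \<in> closure B0" "norm z \<le> RZ" "\<bar>y\<bar> \<le> c0" for \<beta> z :: "real^'d" and y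
  proof -
    have "\<bar>\<beta> \<bullet> z\<bar> \<le> norm \<beta> * norm z"
      by (rule Cauchy_Schwarz_ineq2)
    also have "\<dots> \<le> RB * RZ"
      using RB[OF that(1)] that(2) by (intro mult_mono) (auto intro: order.trans[OF norm_ge_zero])
    finally show ?thesis
      using that(3) by (simp add: K_def)
  qed
  have Z_bound: "AE \<omega> in M. norm (Z \<omega>) \<le> RZ"
    using A1a(2) by eventually_elim (rule RZ)
  have W_range: "AE \<omega> in M. W \<omega> \<in> {a..b}"
    using AE_in_measure_support_distr[OF rv(4)] A1b by simp
  have V_range: "AE \<omega> in M. V \<omega> \<in> {lv..uv}"
    using AE_in_measure_support_distr[OF rv(2)] A1c by simp
  have h0: "\<bar>h0 w\<bar> \<le> c0" if "w \<in> {a..b}" for w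
  proof -
    have "ereal \<bar>h0 w\<bar> < ereal c0"
      using B3 that by (intro SUP_lessD[of "\<lambda>w. ereal \<bar>h0 w\<bar>"]) (auto simp: sobolev_class_centered_def)
    then show ?thesis
      by simp
  qed
  \<comment> \<open>\<open>H0 (U \<omega>)\<close> and \<open>e \<omega>\<close> differ by a bounded
    amount, so events on \<open>U\<close> can be compared with events on the error alone.\<close>
  have index0: "AE \<omega> in M. \<bar>H0 (U \<omega>) - e \<omega>\<bar> \<le> K"
    using Z_bound W_range B1(1)
  proof eventually_elim
    case (elim \<omega>)
    then show ?case
      using index_bound[of \<beta>0 "Z \<omega>" "h0 (W \<omega>)"] h0[of "W \<omega>"] B2(3) closure_subset[of B0] by auto
  qed

  \<comment> \<open>Lower bounds for the chances of a success and of a failure at the least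
    favourable values of \<open>V\<close>, which are \<open>lv\<close> and \<open>uv\<close>
    respectively.\<close>
  define p where "p = min (F (H0 lv - K)) (1 - F (H0 uv + K))"
  have p: "0 < p" "p \<le> 1"
    using F_pos F_less_1 by (auto simp: p_def min_le_iff_disj less_imp_le)
  have e_le: "{\<omega> \<in> space M. e \<omega> \<le> t} \<in> events" for t
    by measurable
  have success: "p * prob {\<omega> \<in> space M. V \<omega> \<in> B} \<le> prob {\<omega> \<in> space M. V \<omega> \<in> B \<and> U \<omega> \<le> V \<omega>}"
    if [measurable]: "B \<in> sets borel" for B
  proof -
    \<comment> \<open>As \<open>H0\<close> is strictly increasing, a sufficiently small error forces
      \<open>U\<close> to be at most \<open>lv\<close>, hence at most \<open>V\<close>.\<close>
    have "AE \<omega> in M. \<omega> \<in> {\<omega> \<in> space M. e \<omega> \<le> H0 lv - K} \<longrightarrow> U \<omega> \<in> {..lv}"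
      using index0
    proof eventually_elim
      case (elim \<omega>)
      then show ?case
        using strict_mono_less_eq[OF B4(1), of "U \<omega>" lv] by auto
    qed
    then have "F (H0 lv - K) * prob {\<omega> \<in> space M. V \<omega> \<in> B} \<le> prob {\<omega> \<in> space M. U \<omega> \<in> {..lv} \<and> V \<omega> \<in> B}"
      by (intro cond_indep_prob_ge[OF ZW A4 _ _ _ _ e_le B1(2)]) auto
    also have "\<dots> \<le> prob {\<omega> \<in> space M. V \<omega> \<in> B \<and> U \<omega> \<le> V \<omega>}"
    proof (rule finite_measure_mono_AE)
      show "AE \<omega> in M. \<omega> \<in> {\<omega> \<in> space M. U \<omega> \<in> {..lv} \<and> V \<omega> \<in> B} \<longrightarrow>
          \<omega> \<in> {\<omega> \<in> space M. V \<omega> \<in> B \<and> U \<omega> \<le> V \<omega>}"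
        using V_range by eventually_elim auto
    qed measurable
    finally show ?thesis
      by (rule order.trans[rotated]) (auto intro!: mult_right_mono simp: p_def)
  qed
  have failure: "p * prob {\<omega> \<in> space M. V \<omega> \<in> B} \<le> prob {\<omega> \<in> space M. V \<omega> \<in> B \<and> \<not> U \<omega> \<le> V \<omega>}"
    if [measurable]: "B \<in> sets borel" for B
  proof -
    \<comment> \<open>Failures are handled through the complement: a success implies
      \<open>U \<le> uv\<close>, which caps the error at \<open>H0 uv + K\<close>.\<close>
    have "AE \<omega> in M. U \<omega> \<in> {..uv} \<longrightarrow> \<omega> \<in> {\<omega> \<in> space M. e \<omega> \<le> H0 uv + K}"
      using index0 AE_space
    proof eventually_elim
      case (elim \<omega>)
      then show ?case
        using strict_mono_less_eq[OF B4(1), of "U \<omega>" uv] by auto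
    qed
    then have "prob {\<omega> \<in> space M. U \<omega> \<in> {..uv} \<and> V \<omega> \<in> B} \<le> F (H0 uv + K) * prob {\<omega> \<in> space M. V \<omega> \<in> B}"
      by (intro cond_indep_prob_le[OF ZW A4 _ _ _ _ e_le B1(2)]) auto
    moreover have "prob {\<omega> \<in> space M. V \<omega> \<in> B \<and> U \<omega> \<le> V \<omega>} \<le> prob {\<omega> \<in> space M. U \<omega> \<in> {..uv} \<and> V \<omega> \<in> B}"
    proof (rule finite_measure_mono_AE)
      show "AE \<omega> in M. \<omega> \<in> {\<omega> \<in> space M. V \<omega> \<in> B \<and> U \<omega> \<le> V \<omega>} \<longrightarrow>
          \<omega> \<in> {\<omega> \<in> space M. U \<omega> \<in> {..uv} \<and> V \<omega> \<in> B}"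
        using V_range by eventually_elim auto
    qed measurable
    moreover have "prob {\<omega> \<in> space M. V \<omega> \<in> B} =
        prob {\<omega> \<in> space M. V \<omega> \<in> B \<and> U \<omega> \<le> V \<omega>} + prob {\<omega> \<in> space M. V \<omega> \<in> B \<and> \<not> U \<omega> \<le> V \<omega>}"
      by (subst finite_measure_Union[symmetric]) (auto intro!: arg_cong[where f = prob])
    ultimately have "(1 - F (H0 uv + K)) * prob {\<omega> \<in> space M. V \<omega> \<in> B} \<le>
        prob {\<omega> \<in> space M. V \<omega> \<in> B \<and> \<not> U \<omega> \<le> V \<omega>}"
      by (simp add: algebra_simps)
    then show ?thesis
      by (rule order.trans[rotated]) (auto intro!: mult_right_mono simp: p_def)
  qed

  \<comment> \<open>Almost sure facts pass from the model to each \<open>X i\<close> through a Borel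
    set of observations. The ball of radius \<open>RZ\<close> is closed, whereas \<open>\<Z>\<close>
    is an arbitrary bounded set.\<close>
  define good where "good = {x :: 'd obs. obs_\<delta> x \<in> {0, 1} \<and> norm (fst (snd (snd x))) \<le> RZ \<and> obs_w x \<in> {a..b}}"
  have "good = ({x. obs_\<delta> x = 0} \<union> {x. obs_\<delta> x = 1}) \<inter> {x. norm (fst (snd (snd x))) \<le> RZ} \<inter>
      {x. a \<le> obs_w x} \<inter> {x. obs_w x \<le> b}"
    by (auto simp: good_def)
  moreover have "closed \<dots>"
    unfolding obs_\<delta>_def obs_w_def
    by (intro closed_Int closed_Un closed_Collect_eq closed_Collect_le continuous_intros)
  ultimately have good_borel: "good \<in> sets borel"
    by (simp add: borel_closed)
  have X_good: "AE \<omega> in M. X i \<omega> \<in> good" if "1 \<le> i" for i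
  proof -
    have "AE \<omega> in M. ?T \<omega> \<in> good"
      using Z_bound W_range by eventually_elim (auto simp: good_def obs_\<delta>_def obs_w_def)
    then have "AE x in distr M borel ?T. x \<in> good"
      using good_borel by (subst AE_distr_iff[OF T]) auto
    then have "AE x in distr M borel (X i). x \<in> good"
      by (subst iid(3)[OF that])
    then show ?thesis
      using good_borel by (subst (asm) AE_distr_iff[OF iid(1)[OF that]]) auto
  qed

  \<comment> \<open>\<open>gf\<close> reverses the order and counts failures as successes, so one
    ratio bound covers both directions.\<close>
  define gs gf :: "'d obs \<Rightarrow> real \<times> bool"
    where "gs x = (obs_v x, obs_\<delta> x = 1)" and "gf x = (- obs_v x, obs_\<delta> x \<noteq> 1)" for x
  let ?N = "borel \<Otimes>\<^sub>M count_space UNIV :: (real \<times> bool) measure"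
  have [measurable]: "obs_v \<in> borel_measurable (borel :: 'd obs measure)"
      "obs_\<delta> \<in> borel_measurable (borel :: 'd obs measure)"
    unfolding obs_v_def obs_\<delta>_def by (intro borel_measurable_continuous_onI continuous_intros)+
  have g[measurable]: "gs \<in> measurable borel ?N" "gf \<in> measurable borel ?N"
    unfolding gs_def gf_def by measurable
  have indep: "indep_vars (\<lambda>_. ?N) (\<lambda>i \<omega>. g (X i \<omega>)) {1..n}" if "g \<in> measurable borel ?N" for g n
    by (rule indep_vars_compose2[OF indep_vars_subset[OF iid(2)]]) (use that in auto)
  have distr_g: "distr M ?N (\<lambda>\<omega>. g (X i \<omega>)) = distr M ?N (\<lambda>\<omega>. g (?T \<omega>))"
    if "g \<in> measurable borel ?N" "i \<in> {1..n}" for g and i n :: nat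
  proof -
    have "distr (distr M borel (X i)) ?N g = distr (distr M borel ?T) ?N g"
      using that by (subst iid(3)) auto
    then show ?thesis
      using that by (simp add: distr_distr[OF that(1)] iid(1) T comp_def)
  qed
  have gT: "(\<lambda>\<omega>. gs (?T \<omega>)) \<in> measurable M ?N" "(\<lambda>\<omega>. gf (?T \<omega>)) \<in> measurable M ?N"
    by (rule measurable_compose[OF T g(1)], rule measurable_compose[OF T g(2)])
  have success_g: "p * measure (distr M ?N (\<lambda>\<omega>. gs (?T \<omega>))) (B \<times> UNIV) \<le>
      measure (distr M ?N (\<lambda>\<omega>. gs (?T \<omega>))) (B \<times> {True})" if "B \<in> sets borel" for B
    using success[OF that] gT(1) that
    by (simp add: measure_distr gs_def obs_v_def obs_\<delta>_def vimage_def Int_def conj_commute)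
  have failure_g: "p * measure (distr M ?N (\<lambda>\<omega>. gf (?T \<omega>))) (B \<times> UNIV) \<le>
      measure (distr M ?N (\<lambda>\<omega>. gf (?T \<omega>))) (B \<times> {True})" if [measurable]: "B \<in> sets borel" for B
  proof -
    have "uminus -` B \<in> sets (borel :: real measure)"
      using measurable_sets[of uminus borel borel B] that by simp
    then show ?thesis
      using failure[of "uminus -` B"] gT(2) that
      by (simp add: measure_distr gf_def obs_v_def obs_\<delta>_def vimage_def Int_def conj_commute)
  qed

  \<comment> \<open>Exceptional sets and the choice of the constant\<close>
  show ?thesis
    unfolding bounded_in_prob_def
  proof (intro allI impI)
    fix \<epsilon> :: real assume "0 < \<epsilon>"
    \<comment> \<open>Half of \<open>\<epsilon>\<close> is reserved for each of the two
      directions.\<close>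
    then have "0 < \<epsilon> / 2"
      by simp
    show "\<exists>C>0. \<forall>\<^sub>F n in sequentially. outer_measure_of M {\<omega> \<in> space M.
        ereal (C * 1) < \<bar>max \<bar>modified_H lv n (\<lambda>i. X i \<omega>) (\<sigma> n \<omega>) (Hhat n \<omega>) lv\<bar>
          \<bar>modified_H lv n (\<lambda>i. X i \<omega>) (\<sigma> n \<omega>) (Hhat n \<omega>) uv\<bar>\<bar>} < ennreal \<epsilon>"
    proof (rule success_ratio_bound[OF p \<open>0 < \<epsilon> / 2\<close>])
      fix \<rho> :: real
      assume "0 < \<rho>" and ratio: "\<And>M I Y \<mu>. prob_space M \<Longrightarrow> finite I \<Longrightarrow>
      prob_space.indep_vars M (\<lambda>_. borel \<Otimes>\<^sub>M count_space UNIV) Y I \<Longrightarrow>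
      (\<And>i. i \<in> I \<Longrightarrow> distr M (borel \<Otimes>\<^sub>M count_space UNIV) (Y i) = \<mu>) \<Longrightarrow>
      (\<And>B. B \<in> sets borel \<Longrightarrow> p * measure \<mu> (B \<times> UNIV) \<le> measure \<mu> (B \<times> {True})) \<Longrightarrow>
      \<exists>E\<in>sets M. measure M E < \<epsilon> / 2 \<and> (\<forall>\<omega>\<in>space M - E.
        success_ratio_ge \<rho> I {i \<in> I. snd (Y i \<omega>)} (\<lambda>i. fst (Y (i::nat) (\<omega>::'a))))"
      \<comment> \<open>\<open>C1\<close> and \<open>C2\<close> are obtained from
        \<open>\<rho>\<close> and \<open>K\<close> before \<open>n\<close> is fixed, so they are
        uniform in the sample size.\<close>
      obtain C1 where "0 < C1" and C1: "\<forall>I s a v H. finite (I :: nat set) \<longrightarrow> s \<subseteq> I \<longrightarrow> (\<forall>i\<in>I. \<bar>a i\<bar> \<le> K) \<longrightarrow>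
        isotonic_mle F I s a v H \<longrightarrow> success_ratio_ge \<rho> I s v \<longrightarrow> (\<forall>j\<in>s. ereal (- C1) \<le> H (v j))"
        using isotonic_mle_lower_bound[OF \<open>0 < \<rho>\<close>, where K = K] by (elim exE conjE)
      obtain C2 where "0 < C2" and C2: "\<forall>I s a v H. finite (I :: nat set) \<longrightarrow> s \<subseteq> I \<longrightarrow> (\<forall>i\<in>I. \<bar>a i\<bar> \<le> K) \<longrightarrow>
        isotonic_mle F I s a v H \<longrightarrow> success_ratio_ge \<rho> I (I - s) (\<lambda>i. - v i) \<longrightarrow> (\<forall>j\<in>I - s. H (v j) \<le> ereal C2)"
        using isotonic_mle_upper_bound[OF \<open>0 < \<rho>\<close>, where K = K] by (elim exE conjE)
      define C where "C = max C1 C2"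
      have "outer_measure_of M {\<omega> \<in> space M.
        ereal (C * 1) < \<bar>max \<bar>modified_H lv n (\<lambda>i. X i \<omega>) (\<sigma> n \<omega>) (Hhat n \<omega>) lv\<bar>
          \<bar>modified_H lv n (\<lambda>i. X i \<omega>) (\<sigma> n \<omega>) (Hhat n \<omega>) uv\<bar>\<bar>} < ennreal \<epsilon>" (is "outer_measure_of M ?bad < _")
        if n: "1 \<le> n" for n
      proof -
        have "\<exists>E\<in>events. prob E < \<epsilon> / 2 \<and> (\<forall>\<omega>\<in>space M - E.
            success_ratio_ge \<rho> {1..n} {i \<in> {1..n}. snd (gs (X i \<omega>))} (\<lambda>i. fst (gs (X i \<omega>))))"
          by (rule ratio[OF prob _ indep[OF g(1)] distr_g[OF g(1)] success_g]) auto
        then obtain E1 where E1: "E1 \<in> events" "prob E1 < \<epsilon> / 2" "\<forall>\<omega>\<in>space M - E1.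
            success_ratio_ge \<rho> {1..n} {i \<in> {1..n}. snd (gs (X i \<omega>))} (\<lambda>i. fst (gs (X i \<omega>)))"
          by blast
        have "\<exists>E\<in>events. prob E < \<epsilon> / 2 \<and> (\<forall>\<omega>\<in>space M - E.
            success_ratio_ge \<rho> {1..n} {i \<in> {1..n}. snd (gf (X i \<omega>))} (\<lambda>i. fst (gf (X i \<omega>))))"
          by (rule ratio[OF prob _ indep[OF g(2)] distr_g[OF g(2)] failure_g]) auto
        then obtain E2 where E2: "E2 \<in> events" "prob E2 < \<epsilon> / 2" "\<forall>\<omega>\<in>space M - E2.
            success_ratio_ge \<rho> {1..n} {i \<in> {1..n}. snd (gf (X i \<omega>))} (\<lambda>i. fst (gf (X i \<omega>)))"
          by blast
        have "AE \<omega> in M. \<forall>i\<in>{1..n}. X i \<omega> \<in> good"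
          by (rule AE_finite_allI) (auto intro: X_good)
        then have "AE \<omega> in M. (\<forall>i\<in>{1..n}. X i \<omega> \<in> good) \<and>
            is_MPLE F B0 c0 a b \<nu> n (\<lambda>i. X i \<omega>) (lam n \<omega>) (\<beta>hat n \<omega>) (hhat n \<omega>) (Hhat n \<omega>)"
          using MPLE[OF n] by eventually_elim simp
        then obtain E3 where E3: "E3 \<in> null_sets M"
          "{\<omega> \<in> space M. \<not> ((\<forall>i\<in>{1..n}. X i \<omega> \<in> good) \<and>
            is_MPLE F B0 c0 a b \<nu> n (\<lambda>i. X i \<omega>) (lam n \<omega>) (\<beta>hat n \<omega>) (hhat n \<omega>) (Hhat n \<omega>))} \<subseteq> E3"
          by (auto simp: eventually_ae_filter)
        have bounded: "max \<bar>modified_H lv n (\<lambda>i. X i \<omega>) (\<sigma> n \<omega>) (Hhat n \<omega>) lv\<bar>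
          \<bar>modified_H lv n (\<lambda>i. X i \<omega>) (\<sigma> n \<omega>) (Hhat n \<omega>) uv\<bar> \<le> ereal C"
          if \<omega>: "\<omega> \<in> space M" "\<omega> \<notin> E1" "\<omega> \<notin> E2" "\<omega> \<notin> E3" for \<omega>
        proof -
          have X: "X i \<omega> \<in> good" if "i \<in> {1..n}" for i
            using E3(2) \<omega> that by blast
          have mple: "is_MPLE F B0 c0 a b \<nu> n (\<lambda>i. X i \<omega>) (lam n \<omega>) (\<beta>hat n \<omega>) (hhat n \<omega>) (Hhat n \<omega>)"
            using E3(2) \<omega> by blast
          then have H: "mono (Hhat n \<omega>)" and \<beta>: "\<beta>hat n \<omega> \<in> closure B0"
            and h: "\<And>w. w \<in> {a..b} \<Longrightarrow> \<bar>hhat n \<omega> w\<bar> \<le> c0"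
            by (auto simp: is_MPLE_def admissible_def)
          define s where "s = {i \<in> {1..n}. obs_\<delta> (X i \<omega>) = 1}"
          let ?\<theta> = "\<lambda>i. \<beta>hat n \<omega> \<bullet> fst (snd (snd (X i \<omega>))) + hhat n \<omega> (obs_w (X i \<omega>))"
          have \<theta>: "\<bar>?\<theta> i\<bar> \<le> K" if "i \<in> {1..n}" for i
            using X[OF that] by (intro index_bound \<beta> h) (auto simp: good_def)
          have mle: "isotonic_mle F {1..n} s ?\<theta> (\<lambda>i. obs_v (X i \<omega>)) (Hhat n \<omega>)"
            unfolding s_def using X by (intro is_MPLE_imp_isotonic_mle[OF mple n]) (auto simp: good_def)
          have s: "{i \<in> {1..n}. snd (gs (X i \<omega>))} = s" "{i \<in> {1..n}. snd (gf (X i \<omega>))} = {1..n} - s"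
            by (auto simp: s_def gs_def gf_def)
          have fst_g: "(\<lambda>i. fst (gs (X i \<omega>))) = (\<lambda>i. obs_v (X i \<omega>))" "(\<lambda>i. fst (gf (X i \<omega>))) = (\<lambda>i. - obs_v (X i \<omega>))"
            by (simp_all add: gs_def gf_def)
          have ratio_s: "success_ratio_ge \<rho> {1..n} s (\<lambda>i. obs_v (X i \<omega>))"
            using E1(3) \<omega> unfolding fst_g[symmetric] s(1)[symmetric] by blast
          have ratio_f: "success_ratio_ge \<rho> {1..n} ({1..n} - s) (\<lambda>i. - obs_v (X i \<omega>))"
            using E2(3) \<omega> unfolding fst_g[symmetric] s(2)[symmetric] by blast
          have sn: "finite {1..n}" "s \<subseteq> {1..n}"
            by (auto simp: s_def)
          note lower = C1[rule_format, OF sn \<theta> mle ratio_s]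
          note upper = C2[rule_format, OF sn \<theta> mle ratio_f]
          have C: "0 \<le> C" "ereal (- C) \<le> ereal (- C1)" "ereal C2 \<le> ereal C"
            using \<open>0 < C1\<close> by (auto simp: C_def)
          have "\<bar>modified_H lv n (\<lambda>i. X i \<omega>) (\<sigma> n \<omega>) (Hhat n \<omega>) t\<bar> \<le> ereal C" for t
          proof (rule modified_H_bounds[OF order[OF n \<omega>(1)] _ H C(1)])
            fix i assume i: "i \<in> {1..n}"
            show "obs_\<delta> (X i \<omega>) \<in> {0, 1}"
              using X[OF i] by (simp add: good_def)
            show "ereal (- C) \<le> Hhat n \<omega> (obs_v (X i \<omega>))" if "obs_\<delta> (X i \<omega>) = 1"
              using lower[of i] order.trans[OF C(2)] i that unfolding s_def by blast
            show "Hhat n \<omega> (obs_v (X i \<omega>)) \<le> ereal C" if "obs_\<delta> (X i \<omega>) = 0"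
              using upper[of i] order.trans[OF _ C(3)] i that unfolding s_def by force
          qed
          then show ?thesis
            by simp
        qed
        have abs_max: "\<bar>max \<bar>x\<bar> \<bar>y\<bar>\<bar> = max \<bar>x\<bar> \<bar>y\<bar>" for x y :: ereal
          by (simp add: max_def)
        \<comment> \<open>The bad set need not be measurable; a measurable cover bounds its outer
          measure.\<close>
        have "?bad \<subseteq> E1 \<union> E2 \<union> E3"
          unfolding abs_max mult_1_right using bounded not_le by blast
        then have "outer_measure_of M ?bad \<le> emeasure M (E1 \<union> E2 \<union> E3)"
          unfolding outer_measure_of_def using E1 E2 E3 by (intro INF_lower) auto
        also have "\<dots> = emeasure M (E1 \<union> E2)"
          using E1 E2 E3 by (intro emeasure_Un_null_set) auto
        also have "\<dots> = ennreal (prob (E1 \<union> E2))"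
          by (rule emeasure_eq_measure)
        also have "\<dots> < ennreal \<epsilon>"
          using E1 E2 \<open>0 < \<epsilon>\<close> measure_Un_le[of E1 M E2] by (intro ennreal_lessI) auto
        finally show ?thesis .
      qed
      then have "\<forall>\<^sub>F n in sequentially. outer_measure_of M {\<omega> \<in> space M.
        ereal (C * 1) < \<bar>max \<bar>modified_H lv n (\<lambda>i. X i \<omega>) (\<sigma> n \<omega>) (Hhat n \<omega>) lv\<bar>
          \<bar>modified_H lv n (\<lambda>i. X i \<omega>) (\<sigma> n \<omega>) (Hhat n \<omega>) uv\<bar>\<bar>} < ennreal \<epsilon>"
        by (rule eventually_sequentiallyI[of 1])
      moreover have "0 < C"
        using \<open>0 < C1\<close> by (simp add: C_def)
      ultimately show ?thesis
        by (intro exI[of _ C] conjI)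
    qed
  qed
qed

end
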